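(* There is an absolute constant $c>0$ such that the following holds. Let $\xi_1,\dots,\xi_n$ be i.i.d. copies of a real random variable $\xi$. Let $F(t)=\mathbb P(|\xi|>t)$ for $t\ge0$, and assume that $F$ is strictly decreasing on $[0,\infty)$, $F(0)=1$, and that $N(t)=\ln\frac1{F(t)}$, $t\ge 0$, is convex. Let $$M(s)=\int_0^s\int_{\{\frac1t\le|\xi|\}}|\xi|\,d\mathbb P\,dt,\qquad s\ge 0.$$ Let $1<k\le n$ and $k_0=\left[\frac{4(k-1)}{F(1)}\right]$, and assume $k+k_0\le n$. Then for all $x_1\ge x_2\ge\dots\ge x_n>0$ $$\frac14\left(\max_{0\le\ell\le k_0-1}\big\|(1/x_i)_{i=1}^{k+\ell}\big\|^{-1}_{\frac{2e}{\ell+1}N}+\Big(1+\frac{\ln(8(k-1))}{N(1)}\Big)^{-1}\big\|(x_{k+k_0},\dots,x_n)\big\|_M\right)$$ $$\le\ \mathbb E\ k\text{-}\max_{1\le i\le n}|x_i\xi_i|\ \le\ c\left(C_N\ln(k+1)\max_{0\le\ell\le k_0-1}\big\|(1/x_i)_{i=1}^{k+\ell}\big\|^{-1}_{\frac{2e}{\ell+1}N}+\big\|(x_{k+k_0},\dots,x_n)\big\|_M\right),$$ where $C_N=\max\{N(1),1/N(1)\}$.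
   Context: For real numbers $a_1,\dots,a_n$, $k\text{-}\max_{1\le i\le n}a_i$ denotes the $k$-th largest of them (counted with multiplicity). $[\cdot]$ denotes the integer part. An Orlicz function is a left continuous convex function $M:[0,\infty)\to[0,\infty]$ with $M(0)=0$ that is neither identically $0$ nor the function equal to $0$ at $0$ and $\infty$ elsewhere. For an Orlicz function $M$ and a finite vector $x=(x_i)_i$, put $$\|x\|_M=\inf\Big\{\rho>0:\ \sum_i M(|x_i|/\rho)\le 1\Big\}.$$ Equivalently, the function $M$ in the claim is $M(s)=\mathbb E\,(s|\xi|-1)_+$; it is an Orlicz function. *)

theory Defs
  imports "HOL-Probability.Probability"
begin

definition k_max :: "nat \<Rightarrow> real list \<Rightarrow> real" where
  "k_max k as = rev (sort as) ! (k - 1)"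

(* Only the values of M on [0,\<infinity>) matter. *)
definition orlicz_norm :: "(real \<Rightarrow> ennreal) \<Rightarrow> 'i set \<Rightarrow> ('i \<Rightarrow> real) \<Rightarrow> real" where
  "orlicz_norm M I x = Inf {\<rho>. \<rho> > 0 \<and> (\<Sum>i\<in>I. M (\<bar>x i\<bar> / \<rho>)) \<le> 1}"

definition tail_prob :: "'a measure \<Rightarrow> ('a \<Rightarrow> real) \<Rightarrow> real \<Rightarrow> real" where
  "tail_prob P \<xi> t = measure P {\<omega> \<in> space P. \<bar>\<xi> \<omega>\<bar> > t}"

definition log_tail :: "'a measure \<Rightarrow> ('a \<Rightarrow> real) \<Rightarrow> real \<Rightarrow> real" where
  "log_tail P \<xi> t = ln (1 / tail_prob P \<xi> t)"

(* The interval integral runs over the open interval (0,s), so the convention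
   1 / 0 = 0 plays no role. *)
definition tail_orlicz :: "'a measure \<Rightarrow> ('a \<Rightarrow> real) \<Rightarrow> real \<Rightarrow> real" where
  "tail_orlicz P \<xi> s =
     (LBINT t=ereal 0..ereal s. (LINT \<omega>:{\<omega> \<in> space P. 1 / t \<le> \<bar>\<xi> \<omega>\<bar>}|P. \<bar>\<xi> \<omega>\<bar>))"

definition k0 :: "'a measure \<Rightarrow> ('a \<Rightarrow> real) \<Rightarrow> nat \<Rightarrow> nat" where
  "k0 P \<xi> k = nat \<lfloor>4 * (real k - 1) / tail_prob P \<xi> 1\<rfloor>"

(* Under the hypotheses of admissible_constant, k0 P \<xi> k \<ge> 4, so the index set is nonempty. *)
definition max_term :: "'a measure \<Rightarrow> ('a \<Rightarrow> real) \<Rightarrow> nat \<Rightarrow> (nat \<Rightarrow> real) \<Rightarrow> real" where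
  "max_term P \<xi> k x =
     (MAX l\<in>{0..k0 P \<xi> k - 1}.
        inverse (orlicz_norm (\<lambda>s. ennreal (2 * exp 1 / (real l + 1) * log_tail P \<xi> s))
                   {1..k + l} (\<lambda>i. 1 / x i)))"

definition sum_term :: "'a measure \<Rightarrow> ('a \<Rightarrow> real) \<Rightarrow> nat \<Rightarrow> nat \<Rightarrow> (nat \<Rightarrow> real) \<Rightarrow> real" where
  "sum_term P \<xi> n k x = orlicz_norm (\<lambda>s. ennreal (tail_orlicz P \<xi> s)) {k + k0 P \<xi> k..n} x"

(* c makes the two-sided estimate hold for all random variables on sample spaces of type 'a.
   The lower bound is strictly positive, so the estimate entails integrability of the k-max
   (the Bochner integral of a non-integrable function is 0). *)
definition admissible_constant :: "'a itself \<Rightarrow> real \<Rightarrow> bool" where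
  "admissible_constant T c \<longleftrightarrow>
     (\<forall>(P :: 'a measure) (\<xi> :: 'a \<Rightarrow> real) (X :: nat \<Rightarrow> 'a \<Rightarrow> real) (n :: nat) (k :: nat)
        (x :: nat \<Rightarrow> real).
        prob_space P \<and>
        \<xi> \<in> borel_measurable P \<and>
        prob_space.indep_vars P (\<lambda>_. borel) X {1..n} \<and>
        (\<forall>i\<in>{1..n}. distr P borel (X i) = distr P borel \<xi>) \<and>
        strict_antimono_on {0..} (tail_prob P \<xi>) \<and>
        tail_prob P \<xi> 0 = 1 \<and>
        convex_on {0..} (log_tail P \<xi>) \<and>
        1 < k \<and> k \<le> n \<and> k + k0 P \<xi> k \<le> n \<and>
        antimono_on {1..n} x \<and> (\<forall>i\<in>{1..n}. 0 < x i)
        \<longrightarrow>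
        (let N = log_tail P \<xi>;
             C_N = max (N 1) (1 / N 1);
             E_kmax = (LINT \<omega>|P. k_max k (map (\<lambda>i. \<bar>x i * X i \<omega>\<bar>) [1..<n + 1]))
         in 1 / 4 * (max_term P \<xi> k x
                     + inverse (1 + ln (8 * (real k - 1)) / N 1) * sum_term P \<xi> n k x)
              \<le> E_kmax \<and>
            E_kmax \<le> c * (C_N * ln (real k + 1) * max_term P \<xi> k x + sum_term P \<xi> n k x)))"

(* An absolute constant must serve sample spaces of every type. HOL cannot quantify over types
   under an existential quantifier. Instead one can require that a constant c > 0 exists for
   the closed type nat => real, and that each c admissible there is admissible for an
   arbitrary type 'a; together these say that one single c works for all types. *)

end

theory Submission
  imports Defs
begin

text \<open>
  Write \<open>F = exp (- N)\<close> for the tail of \<open>\<xi>\<close>, \<open>A\<close> for the maximum over \<open>l\<close>, \<open>B\<close> for the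
  Orlicz norm of \<open>(x\<^sub>m, \<dots>, x\<^sub>n)\<close>, \<open>m = k + k\<^sub>0\<close>, and \<open>D = 1 + ln (8 (k - 1)) / N 1\<close>. Since
  \<open>E w^cnt = \<Prod> (1 + (w - 1) F (t / x\<^sub>i))\<close> for the number \<open>cnt\<close> of weighted variables exceeding
  \<open>t\<close>, everything reduces to Chernoff bounds.

  Lower bound. If \<open>\<Sum> N (t / x\<^sub>i) \<le> (l + 1) / (2 e)\<close> over \<open>i \<le> k + l\<close>, then with probability at least
  \<open>1 / 2\<close> at most \<open>l\<close> of these variables are \<open>\<le> t\<close>; this gives \<open>A \<le> 2 E k-max\<close>. Convexity of \<open>N\<close>
  gives \<open>F (D u) \<le> F u / (8 (k - 1))\<close> for \<open>u \<ge> 1\<close>. If the k-max exceeds \<open>s = t / D\<close> with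
  probability less than \<open>1 / 2\<close>, the mean number of exceedances of \<open>s\<close> is below \<open>4 (k - 1)\<close>; by the
  choice of \<open>k\<^sub>0\<close> this forces \<open>s > x\<^sub>m\<close>, so \<open>\<Sum> F (t / x\<^sub>i) < 1 / 2\<close> over \<open>i \<ge> m\<close>, and the
  geometric decay of \<open>F\<close> turns this into \<open>\<Sum> M (x\<^sub>i / t) \<le> 1\<close>, i.e. \<open>B \<le> t\<close>.

  Upper bound. The k-max is at most the k-max of the first \<open>m - 1\<close> variables plus
  \<open>\<rho> + \<Sum> (\<bar>x\<^sub>i \<xi>\<^sub>i\<bar> - \<rho>)\<^sub>+\<close> over \<open>i \<ge> m\<close>, whose expectation is at most \<open>2 \<rho>\<close> when
  \<open>\<Sum> M (x\<^sub>i / \<rho>) \<le> 1\<close>. For the first part, \<open>b\<^sub>i = N (2 A / x\<^sub>i)\<close> is increasing with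
  \<open>\<Sum> b\<^sub>i \<ge> (l + 1) / (2 e)\<close> over \<open>i \<le> k + l\<close>. The indices with \<open>b\<^sub>i \<ge> 1 / (8 e)\<close> are handled by the
  union bound; the others form an initial segment of some length \<open>k + l\<close>, on which at most \<open>l\<close>
  variables stay below the level \<open>2 A d\<close>, and Chernoff's bound applies with \<open>w = exp (d / (4 e))\<close>.
\<close>

subsection \<open>Order statistics and expectations\<close>

text \<open>In the decreasing rearrangement \<open>r\<close> the positions with value above
  \<open>t\<close> form an initial segment, so their number decides whether position
  \<open>k - 1\<close> lies in it. Order statistics thereby become counts.\<close>

lemma k_max_greater_iff:
  assumes "1 \<le> k" "k \<le> length as"
  shows "t < k_max k as \<longleftrightarrow> k \<le> length (filter (\<lambda>a. t < a) as)"
proof -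
  define r where "r = rev (sort as)"
  define S where "S = {i. i < length r \<and> t < r ! i}"
  have len: "length r = length as" by (simp add: r_def)
  have desc: "r ! j \<le> r ! i" if "i \<le> j" "j < length r" for i j
    using that by (intro sorted_rev_nth_mono) (auto simp: r_def)
  have "length (filter (\<lambda>a. t < a) as) = size (filter_mset (\<lambda>a. t < a) (mset r))"
    by (metis r_def mset_filter mset_rev mset_sort size_mset)
  also have "\<dots> = card S"
    by (metis S_def length_filter_conv_card mset_filter size_mset)
  finally have card_S: "length (filter (\<lambda>a. t < a) as) = card S" .
  have fin: "finite S" by (simp add: S_def)
  show ?thesis
  proof
    assume "t < k_max k as"
    then have "t < r ! (k - 1)" by (simp add: k_max_def r_def)
    then have "{..<k} \<subseteq> S"
      using desc[of _ "k - 1"] assms len by (fastforce simp: S_def intro: less_le_trans)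
    from card_mono[OF fin this] show "k \<le> length (filter (\<lambda>a. t < a) as)"
      by (simp add: card_S)
  next
    assume *: "k \<le> length (filter (\<lambda>a. t < a) as)"
    show "t < k_max k as"
    proof (rule ccontr)
      assume "\<not> t < k_max k as"
      then have "r ! (k - 1) \<le> t" by (simp add: k_max_def r_def)
      then have "j < k - 1" if "j \<in> S" for j
        using desc[of "k - 1" j] that by (cases "j < k - 1") (auto simp: S_def)
      then have "S \<subseteq> {..<k - 1}" by auto
      from card_mono[OF _ this] * assms show False by (simp add: card_S)
    qed
  qed
qed

lemma k_max_map_greater_iff:
  fixes a :: "nat \<Rightarrow> real"
  assumes "1 \<le> k" "k \<le> n"
  shows "t < k_max k (map a [1..<n + 1]) \<longleftrightarrow> k \<le> card {i\<in>{1..n}. t < a i}"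
proof -
  have "length (filter (\<lambda>a. t < a) (map a [1..<n + 1])) = length (filter (\<lambda>i. t < a i) [1..<n + 1])"
    by (simp add: filter_map o_def)
  also have "\<dots> = card (set (filter (\<lambda>i. t < a i) [1..<n + 1]))"
    by (rule distinct_card[symmetric]) simp
  also have "set (filter (\<lambda>i. t < a i) [1..<n + 1]) = {i\<in>{1..n}. t < a i}"
    by auto
  finally show ?thesis
    using k_max_greater_iff[of k "map a [1..<n + 1]" t] assms by simp
qed

lemma k_max_nonneg:
  assumes "1 \<le> k" "k \<le> length as" "\<And>a. a \<in> set as \<Longrightarrow> 0 \<le> a"
  shows "0 \<le> k_max k as"
proof -
  have "k_max k as \<in> set (rev (sort as))"
    unfolding k_max_def using assms by (intro nth_mem) simp
  then show ?thesis using assms(3) by simp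
qed

text \<open>No index beyond \<open>q\<close> can exceed \<open>y + z\<close>, since its own excess
  over \<open>\<rho>\<close> is part of \<open>z\<close>. So \<open>k\<close> indices exceeding
  \<open>y + z\<close> would all lie in the first block and exceed its k-max
  \<open>y\<close>.\<close>

lemma k_max_split_le:
  fixes a :: "nat \<Rightarrow> real"
  assumes "1 \<le> k" "k \<le> q" "q \<le> n" and nonneg: "\<And>i. 0 \<le> a i" and "0 \<le> \<rho>"
  shows "k_max k (map a [1..<n + 1])
    \<le> k_max k (map a [1..<q + 1]) + (\<rho> + (\<Sum>i\<in>{q + 1..n}. max 0 (a i - \<rho>)))"
proof (rule ccontr)
  define y where "y = k_max k (map a [1..<q + 1])"
  define z where "z = \<rho> + (\<Sum>i\<in>{q + 1..n}. max 0 (a i - \<rho>))"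
  assume "\<not> k_max k (map a [1..<n + 1]) \<le> y + z"
  then have "y + z < k_max k (map a [1..<n + 1])" by simp
  then have card: "k \<le> card {i\<in>{1..n}. y + z < a i}"
    using assms by (subst (asm) k_max_map_greater_iff) auto
  have "0 \<le> y"
    unfolding y_def using assms by (intro k_max_nonneg) auto
  have "0 \<le> z" unfolding z_def using assms by (auto intro!: add_nonneg_nonneg sum_nonneg)
  have "a i \<le> y + z" if "i \<in> {q + 1..n}" for i
  proof -
    have "max 0 (a i - \<rho>) \<le> (\<Sum>i\<in>{q + 1..n}. max 0 (a i - \<rho>))"
      using that by (intro member_le_sum) auto
    with \<open>0 \<le> y\<close> show ?thesis unfolding z_def by linarith
  qed
  then have "{i\<in>{1..n}. y + z < a i} \<subseteq> {i\<in>{1..q}. y < a i}"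
    using \<open>0 \<le> z\<close> by (force simp: not_less_eq_eq)
  from card_mono[OF _ this] card have "k \<le> card {i\<in>{1..q}. y < a i}" by simp
  then have "y < y"
    using assms k_max_map_greater_iff[of k q y a] by (simp add: y_def)
  then show False by simp
qed

lemma k_max_le_sum:
  fixes a :: "nat \<Rightarrow> real"
  assumes "1 \<le> k" "k \<le> n" and nonneg: "\<And>i. 0 \<le> a i"
  shows "k_max k (map a [1..<n + 1]) \<le> (\<Sum>i\<in>{1..n}. a i)"
proof -
  have "k_max k (map a [1..<n + 1]) \<in> set (rev (sort (map a [1..<n + 1])))"
    unfolding k_max_def using assms by (intro nth_mem) simp
  also have "\<dots> = a ` {1..n}" by (auto simp del: upt_Suc)
  finally obtain i where "i \<in> {1..n}" "k_max k (map a [1..<n + 1]) = a i" by blast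
  then show ?thesis using member_le_sum[of i "{1..n}" a] nonneg by simp
qed

section \<open>Measurability, and expectations controlled by tail probabilities\<close>

lemma measurable_card_greater [measurable]:
  fixes f :: "nat \<Rightarrow> 'a \<Rightarrow> real"
  assumes "finite I" and [measurable]: "\<And>i. i \<in> I \<Longrightarrow> f i \<in> borel_measurable M"
  shows "(\<lambda>\<omega>. card {i\<in>I. t < f i \<omega>}) \<in> measurable M (count_space UNIV)"
proof -
  have "(\<lambda>\<omega>. card {i\<in>I. t < f i \<omega>}) = (\<lambda>\<omega>. \<Sum>i\<in>I. if t < f i \<omega> then 1 else 0)"
    using assms(1) by (auto simp: sum.If_cases Int_def)
  then show ?thesis by simp
qed

lemma borel_measurable_k_max:
  fixes f :: "nat \<Rightarrow> 'a \<Rightarrow> real"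
  assumes "1 \<le> k" "k \<le> n" and [measurable]: "\<And>i. i \<in> {1..n} \<Longrightarrow> f i \<in> borel_measurable M"
  shows "(\<lambda>\<omega>. k_max k (map (\<lambda>i. f i \<omega>) [1..<n + 1])) \<in> borel_measurable M"
proof -
  have [measurable]: "(\<lambda>\<omega>. card {i\<in>{1..n}. t < f i \<omega>}) \<in> measurable M (count_space UNIV)" for t
    by (rule measurable_card_greater) auto
  have "{\<omega>\<in>space M. k \<le> card {i\<in>{1..n}. t < f i \<omega>}} \<in> sets M" for t
    by measurable
  then show ?thesis
    unfolding borel_measurable_iff_greater using k_max_map_greater_iff[OF assms(1,2)] by simp
qed

text \<open>A discrete layer-cake bound: the excess of \<open>Y\<close> over \<open>\<tau>\<close>
  is at most \<open>c\<close> times the number of levels \<open>\<tau> + c * j\<close> below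
  \<open>Y\<close>. Integrability is a conclusion, so the lemma applies to \<open>\<xi>\<close>
  itself.\<close>

lemma (in prob_space) expectation_excess_le:
  fixes Y :: "'a \<Rightarrow> real"
  assumes [measurable]: "Y \<in> borel_measurable M" and "0 < c"
    and tail: "\<And>j. prob {\<omega>\<in>space M. \<tau> + c * real j < Y \<omega>} \<le> g j" and "g sums S"
  shows "integrable M (\<lambda>\<omega>. max 0 (Y \<omega> - \<tau>))" (is ?int)
    and "expectation (\<lambda>\<omega>. max 0 (Y \<omega> - \<tau>)) \<le> c * S" (is ?le)
proof -
  define E where "E j = {\<omega>\<in>space M. \<tau> + c * real j < Y \<omega>}" for j
  have [measurable]: "E j \<in> sets M" for j unfolding E_def by measurable
  have g_nonneg: "0 \<le> g j" for j using tail[of j] measure_nonneg by (rule order_trans[rotated])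
  have "0 \<le> S" using sums_le[OF _ sums_zero \<open>g sums S\<close>] g_nonneg by blast
  have bound: "ennreal (max 0 (Y \<omega> - \<tau>)) \<le> (\<Sum>j. ennreal c * indicator (E j) \<omega>)"
    if "\<omega> \<in> space M" for \<omega>
  proof -
    \<comment> \<open>The number of levels strictly below \<open>Y \<omega>\<close>;
      \<open>nat\<close> makes it 0 when \<open>Y \<omega>\<close> is at most
      \<open>\<tau>\<close>.\<close>
    define m where "m = nat \<lceil>(Y \<omega> - \<tau>) / c\<rceil>"
    have below: "\<omega> \<in> E j" if "j < m" for j
    proof -
      have "real j < (Y \<omega> - \<tau>) / c" using that unfolding m_def by linarith
      then show ?thesis
        using \<open>\<omega> \<in> space M\<close> \<open>0 < c\<close> by (simp add: E_def field_simps)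
    qed
    have "(Y \<omega> - \<tau>) / c \<le> real m" unfolding m_def by linarith
    then have "max 0 (Y \<omega> - \<tau>) \<le> c * real m" using \<open>0 < c\<close> by (simp add: field_simps)
    then have "ennreal (max 0 (Y \<omega> - \<tau>)) \<le> ennreal (c * real m)" by (rule ennreal_leI)
    also have "\<dots> = (\<Sum>j<m. ennreal c * indicator (E j) \<omega>)"
      using below \<open>0 < c\<close> by (simp add: ennreal_mult ennreal_of_nat_eq_real_of_nat mult.commute)
    also have "\<dots> \<le> (\<Sum>j. ennreal c * indicator (E j) \<omega>)"
      by (rule sum_le_suminf) auto
    finally show ?thesis .
  qed
  have "(\<integral>\<^sup>+\<omega>. ennreal (max 0 (Y \<omega> - \<tau>)) \<partial>M) \<le> (\<integral>\<^sup>+\<omega>. (\<Sum>j. ennreal c * indicator (E j) \<omega>) \<partial>M)"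
    by (rule nn_integral_mono) (rule bound)
  also have "\<dots> = (\<Sum>j. \<integral>\<^sup>+\<omega>. ennreal c * indicator (E j) \<omega> \<partial>M)"
    by (rule nn_integral_suminf) measurable
  also have "\<dots> = (\<Sum>j. ennreal (c * prob (E j)))"
    using \<open>0 < c\<close> by (simp add: nn_integral_cmult_indicator emeasure_eq_measure ennreal_mult)
  also have "\<dots> \<le> (\<Sum>j. ennreal (c * g j))"
    using tail \<open>0 < c\<close> by (intro suminf_le ennreal_leI mult_left_mono) (auto simp: E_def)
  also have "\<dots> = ennreal (c * S)"
    using sums_mult[OF \<open>g sums S\<close>, of c] g_nonneg \<open>0 < c\<close>
    by (intro suminf_ennreal_eq) auto
  finally have le: "(\<integral>\<^sup>+\<omega>. ennreal (max 0 (Y \<omega> - \<tau>)) \<partial>M) \<le> ennreal (c * S)" .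
  then show ?int
    by (intro integrableI_nonneg) (auto simp: less_top[symmetric] top_unique)
  have "expectation (\<lambda>\<omega>. max 0 (Y \<omega> - \<tau>)) = enn2real (\<integral>\<^sup>+\<omega>. ennreal (max 0 (Y \<omega> - \<tau>)) \<partial>M)"
    by (rule integral_eq_nn_integral) auto
  also have "\<dots> \<le> enn2real (ennreal (c * S))"
    by (rule enn2real_mono) (use le in auto)
  finally show ?le using \<open>0 < c\<close> \<open>0 \<le> S\<close> by simp
qed

lemma (in prob_space) mult_prob_le_expectation:
  fixes Y :: "'a \<Rightarrow> real"
  assumes "integrable M Y" "\<And>\<omega>. 0 \<le> Y \<omega>" "A \<in> events" "\<And>\<omega>. \<omega> \<in> A \<Longrightarrow> t \<le> Y \<omega>"
  shows "t * prob A \<le> expectation Y"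
proof -
  have "t * prob A = expectation (\<lambda>\<omega>. t * indicator A \<omega>)"
    using assms(3) by simp
  also have "\<dots> \<le> expectation Y"
    using assms
    by (intro integral_mono integrable_mult_right integrable_real_indicator)
      (auto simp: indicator_def emeasure_eq_measure)
  finally show ?thesis .
qed

section \<open>The Orlicz function as a mean excess\<close>

lemma nn_integral_hyperbola:
  fixes a s :: real
  assumes "0 \<le> a" "0 \<le> s"
  shows "(\<integral>\<^sup>+t. ennreal (if 0 < t \<and> t < s \<and> 1 / t \<le> a then a else 0) \<partial>lborel)
    = ennreal (max 0 (s * a - 1))"
proof (cases "a = 0")
  case False
  with assms have "0 < a" by simp
  have "ennreal (if 0 < t \<and> t < s \<and> 1 / t \<le> a then a else 0) = ennreal a * indicator {1 / a..<s} t"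
    for t
  proof -
    \<comment> \<open>The guard \<open>0 < t\<close> matters: for nonpositive \<open>t\<close> the
      inequality \<open>1 / t \<le> a\<close> holds as well, \<open>1 / 0\<close> being 0.\<close>
    have "0 < t \<and> 1 / t \<le> a \<longleftrightarrow> 1 / a \<le> t"
    proof (cases "0 < t")
      case True
      then show ?thesis using \<open>0 < a\<close> by (simp add: field_simps)
    next
      case False
      then show ?thesis using \<open>0 < a\<close> by (smt (verit) zero_less_divide_1_iff)
    qed
    then show ?thesis by (auto simp: indicator_def)
  qed
  then have "(\<integral>\<^sup>+t. ennreal (if 0 < t \<and> t < s \<and> 1 / t \<le> a then a else 0) \<partial>lborel)
      = ennreal a * emeasure lborel {1 / a..<s}"
    by (simp add: nn_integral_cmult_indicator)
  also have "emeasure lborel {1 / a..<s} = ennreal (max 0 (s - 1 / a))"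
    by (cases "1 / a \<le> s") (auto simp: max_def)
  also have "ennreal a * \<dots> = ennreal (a * max 0 (s - 1 / a))"
    using \<open>0 < a\<close> by (simp add: ennreal_mult)
  also have "a * max 0 (s - 1 / a) = max 0 (s * a - 1)"
    using \<open>0 < a\<close> by (auto simp: max_def field_simps)
  finally show ?thesis .
qed (simp cong: if_cong)

text \<open>Tonelli for the nonnegative \<open>h\<close>: with \<open>\<omega>\<close> fixed, the
  condition \<open>1 / t \<le> \<bar>\<xi> \<omega>\<bar>\<close> leaves a \<open>t\<close>-interval
  of length \<open>s - 1 / \<bar>\<xi> \<omega>\<bar>\<close>, or none.\<close>

lemma tail_orlicz_eq:
  assumes "prob_space P" and int: "integrable P \<xi>" and "0 \<le> s"
  shows "tail_orlicz P \<xi> s = (\<integral>\<omega>. max 0 (s * \<bar>\<xi> \<omega>\<bar> - 1) \<partial>P)"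
proof -
  interpret prob_space P by fact
  interpret L: pair_sigma_finite P lborel ..
  have [measurable]: "\<xi> \<in> borel_measurable P" using int by simp
  define h where "h t \<omega> = (if 0 < t \<and> t < s \<and> 1 / t \<le> \<bar>\<xi> \<omega>\<bar> then \<bar>\<xi> \<omega>\<bar> else 0)" for t \<omega>
  have [measurable]: "(\<lambda>(\<omega>, t). h t \<omega>) \<in> borel_measurable (P \<Otimes>\<^sub>M lborel)"
    unfolding h_def by measurable
  have h_int: "integrable P (h t)" for t
    by (rule Bochner_Integration.integrable_bound[OF int]) (auto simp: h_def)
  have h_nonneg: "0 \<le> h t \<omega>" for t \<omega> by (simp add: h_def)
  have "tail_orlicz P \<xi> s = (\<integral>t. (\<integral>\<omega>. h t \<omega> \<partial>P) \<partial>lborel)"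
    unfolding tail_orlicz_def interval_lebesgue_integral_def set_lebesgue_integral_def
    using \<open>0 \<le> s\<close>
    by (auto intro!: Bochner_Integration.integral_cong simp: h_def indicator_def)
  also have "\<dots> = enn2real (\<integral>\<^sup>+t. ennreal (\<integral>\<omega>. h t \<omega> \<partial>P) \<partial>lborel)"
    by (rule integral_eq_nn_integral) (auto intro!: Bochner_Integration.integral_nonneg h_nonneg)
  also have "\<dots> = enn2real (\<integral>\<^sup>+t. (\<integral>\<^sup>+\<omega>. ennreal (h t \<omega>) \<partial>P) \<partial>lborel)"
    by (subst nn_integral_eq_integral) (auto simp: h_int h_nonneg)
  also have "\<dots> = enn2real (\<integral>\<^sup>+\<omega>. (\<integral>\<^sup>+t. ennreal (h t \<omega>) \<partial>lborel) \<partial>P)"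
    by (subst L.Fubini') simp_all
  also have "\<dots> = enn2real (\<integral>\<^sup>+\<omega>. ennreal (max 0 (s * \<bar>\<xi> \<omega>\<bar> - 1)) \<partial>P)"
    unfolding h_def using \<open>0 \<le> s\<close> by (simp add: nn_integral_hyperbola)
  also have "\<dots> = (\<integral>\<omega>. max 0 (s * \<bar>\<xi> \<omega>\<bar> - 1) \<partial>P)"
    by (rule integral_eq_nn_integral[symmetric]) auto
  finally show ?thesis .
qed

subsection \<open>Log-concave tails\<close>

locale log_concave_tail = prob_space P for P :: "'a measure" +
  fixes \<xi> :: "'a \<Rightarrow> real"
  assumes \<xi>_measurable [measurable]: "\<xi> \<in> borel_measurable P"
    and tail_strict: "strict_antimono_on {0..} (tail_prob P \<xi>)"
    and tail_0: "tail_prob P \<xi> 0 = 1"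
    and log_tail_convex: "convex_on {0..} (log_tail P \<xi>)"
begin

abbreviation F where "F \<equiv> tail_prob P \<xi>"
abbreviation N where "N \<equiv> log_tail P \<xi>"

lemma F_less: "0 \<le> s \<Longrightarrow> s < t \<Longrightarrow> F t < F s"
  using tail_strict by (auto simp: monotone_on_def)

lemma F_antimono: "0 \<le> s \<Longrightarrow> s \<le> t \<Longrightarrow> F t \<le> F s"
  using F_less[of s t] by (cases "s = t") auto

lemma F_pos: "0 \<le> t \<Longrightarrow> 0 < F t"
  using F_less[of t "t + 1"] by (simp add: tail_prob_def) (meson le_less_trans measure_nonneg)

lemma F_le_1: "F t \<le> 1"
  by (simp add: tail_prob_def)

lemma F_eq_exp: "0 \<le> t \<Longrightarrow> F t = exp (- N t)"
  using F_pos[of t] by (simp add: log_tail_def ln_div)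

lemma N_0: "N 0 = 0"
  by (simp add: log_tail_def tail_0)

lemma N_mono: "0 \<le> s \<Longrightarrow> s \<le> t \<Longrightarrow> N s \<le> N t"
  using F_antimono[of s t] F_eq_exp[of s] F_eq_exp[of t] by simp

lemma N_nonneg: "0 \<le> t \<Longrightarrow> 0 \<le> N t"
  using N_mono[of 0 t] by (simp add: N_0)

lemma N_1_pos: "0 < N 1"
  using F_less[of 0 1] F_eq_exp[of 0] F_eq_exp[of 1] by (simp add: N_0)

lemma N_scale_le: "N (u * t) \<le> u * N t" if "0 \<le> u" "u \<le> 1" "0 \<le> t"
  using convex_onD[OF log_tail_convex, of u 0 t] that by (simp add: N_0)

lemma N_scale_ge: "u * N t \<le> N (u * t)" if "1 \<le> u" "0 \<le> t"
  using N_scale_le[of "1 / u" "u * t"] that by (simp add: field_simps)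

text \<open>Multiples of a level have geometrically decaying tails; the series bounds on
  expectations rest on this.\<close>

lemma F_scale_le: "F (u * t) \<le> exp (- (u * N t))" if "1 \<le> u" "0 \<le> t"
  using N_scale_ge[OF that] F_eq_exp[of "u * t"] that by simp

lemma integrable_\<xi>: "integrable P \<xi>"
proof -
  \<comment> \<open>The form matches \<open>expectation_excess_le\<close> with
    \<open>\<tau> = 0\<close> and \<open>c = 1\<close>; \<open>j = 0\<close> is separate because
    \<open>F_scale_le\<close> needs a factor of at least 1.\<close>
  have "prob {\<omega>\<in>space P. 0 + 1 * real j < \<bar>\<xi> \<omega>\<bar>} \<le> exp (- N 1) ^ j" for j
    using F_scale_le[of "real j" 1] F_le_1[of 0]
    by (cases "j = 0") (auto simp: tail_prob_def exp_of_nat_mult[symmetric])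
  moreover have "(\<lambda>j. exp (- N 1) ^ j) sums (1 / (1 - exp (- N 1)))"
    using N_1_pos by (intro geometric_sums) simp
  ultimately have "integrable P (\<lambda>\<omega>. max 0 (\<bar>\<xi> \<omega>\<bar> - 0))"
    by (intro expectation_excess_le(1)[where c = 1]) auto
  then have "integrable P (\<lambda>\<omega>. \<bar>\<xi> \<omega>\<bar>)"
    by (simp add: max_absorb2)
  then show ?thesis
    by (rule integrable_abs_cancel) simp
qed

lemma integrable_excess: "integrable P (\<lambda>\<omega>. max 0 (s * \<bar>\<xi> \<omega>\<bar> - u))"
  using integrable_\<xi> by (intro integrable_max) auto

lemma tail_orlicz_eq': "0 \<le> s \<Longrightarrow> tail_orlicz P \<xi> s = expectation (\<lambda>\<omega>. max 0 (s * \<bar>\<xi> \<omega>\<bar> - 1))"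
  by (rule tail_orlicz_eq) (auto simp: integrable_\<xi> prob_space_axioms)

lemma tail_orlicz_nonneg: "0 \<le> s \<Longrightarrow> 0 \<le> tail_orlicz P \<xi> s"
  by (simp add: tail_orlicz_eq' Bochner_Integration.integral_nonneg)

lemma tail_orlicz_le: "tail_orlicz P \<xi> s \<le> s * expectation (\<lambda>\<omega>. \<bar>\<xi> \<omega>\<bar>)" if "0 \<le> s"
proof -
  have "expectation (\<lambda>\<omega>. max 0 (s * \<bar>\<xi> \<omega>\<bar> - 1)) \<le> expectation (\<lambda>\<omega>. s * \<bar>\<xi> \<omega>\<bar>)"
    using that integrable_\<xi> by (intro integral_mono integrable_excess) auto
  then show ?thesis using that by (simp add: tail_orlicz_eq')
qed

text \<open>The levels \<open>(1 + j) * u\<close> have tails at most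
  \<open>F u * exp (- N u) ^ j\<close>; the ratio is at most 1/8, and the geometric series sums to
  8/7.\<close>

lemma tail_orlicz_le_tail:
  assumes "0 < u" "ln 8 \<le> N u"
  shows "tail_orlicz P \<xi> (1 / u) \<le> 8 / 7 * F u"
proof -
  have "prob {\<omega>\<in>space P. 1 + 1 * real j < 1 / u * \<bar>\<xi> \<omega>\<bar>} \<le> F u * (1 / 8) ^ j" for j
  proof -
    have "prob {\<omega>\<in>space P. 1 + 1 * real j < 1 / u * \<bar>\<xi> \<omega>\<bar>} = F ((1 + real j) * u)"
      using assms(1) by (simp add: tail_prob_def field_simps)
    also have "\<dots> \<le> exp (- ((1 + real j) * N u))"
      using assms by (intro F_scale_le) auto
    also have "\<dots> = F u * exp (- N u) ^ j"
      using assms by (simp add: F_eq_exp exp_of_nat_mult[symmetric] mult_exp_exp algebra_simps)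
    also have "\<dots> \<le> F u * (1 / 8) ^ j"
    proof -
      have "exp (- N u) \<le> exp (- ln 8)" using assms by simp
      then have "exp (- N u) \<le> 1 / 8" by (simp add: exp_minus inverse_eq_divide)
      then show ?thesis using F_pos[of u] assms by (intro mult_left_mono power_mono) auto
    qed
    finally show ?thesis .
  qed
  moreover have "(\<lambda>j. F u * (1 / 8) ^ j) sums (F u * (1 / (1 - 1 / 8)))"
    by (intro sums_mult geometric_sums) simp
  ultimately have "expectation (\<lambda>\<omega>. max 0 (1 / u * \<bar>\<xi> \<omega>\<bar> - 1)) \<le> 1 * (F u * (1 / (1 - 1 / 8)))"
    by (intro expectation_excess_le(2)) auto
  then show ?thesis using assms by (subst tail_orlicz_eq') auto
qed

end

subsection \<open>Counting exceedances\<close>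

locale weighted_order_statistic = log_concave_tail P \<xi> for P :: "'a measure" and \<xi> +
  fixes X :: "nat \<Rightarrow> 'a \<Rightarrow> real" and n k :: nat and x :: "nat \<Rightarrow> real"
  assumes indep: "indep_vars (\<lambda>_. borel) X {1..n}"
    and distr_eq: "\<And>i. i \<in> {1..n} \<Longrightarrow> distr P borel (X i) = distr P borel \<xi>"
    and k_gt_1: "1 < k"
    and k0_le: "k + k0 P \<xi> k \<le> n"
    and x_antimono: "antimono_on {1..n} x"
    and x_pos: "\<And>i. i \<in> {1..n} \<Longrightarrow> 0 < x i"
begin

definition cnt :: "nat set \<Rightarrow> real \<Rightarrow> 'a \<Rightarrow> nat" where
  "cnt I t \<omega> = card {i\<in>I. t < \<bar>x i * X i \<omega>\<bar>}"

text \<open>The length \<open>m\<close> varies while \<open>k\<close> stays fixed: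
  \<open>m = n\<close> is the full sample, and the upper estimate also uses a leading block.\<close>

definition Kmax :: "nat \<Rightarrow> 'a \<Rightarrow> real" where
  "Kmax m \<omega> = k_max k (map (\<lambda>i. \<bar>x i * X i \<omega>\<bar>) [1..<m + 1])"

lemma x_le: "1 \<le> i \<Longrightarrow> i \<le> j \<Longrightarrow> j \<le> n \<Longrightarrow> x j \<le> x i"
  using x_antimono by (auto simp: monotone_on_def)

lemma X_measurable: "i \<in> {1..n} \<Longrightarrow> X i \<in> borel_measurable P"
  using indep by (auto simp: indep_vars_def)

lemma aX_measurable: "i \<in> {1..n} \<Longrightarrow> (\<lambda>\<omega>. \<bar>x i * X i \<omega>\<bar>) \<in> borel_measurable P"
  using X_measurable[of i] by simp

lemma expectation_X:
  fixes f :: "real \<Rightarrow> real"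
  assumes "i \<in> {1..n}" and [measurable]: "f \<in> borel_measurable borel"
  shows "expectation (\<lambda>\<omega>. f (X i \<omega>)) = expectation (\<lambda>\<omega>. f (\<xi> \<omega>))"
  using integral_distr[of "X i" P borel f] integral_distr[of \<xi> P borel f]
    X_measurable[OF assms(1)] distr_eq[OF assms(1)] by simp

lemma integrable_X_iff:
  fixes f :: "real \<Rightarrow> real"
  assumes "i \<in> {1..n}" and [measurable]: "f \<in> borel_measurable borel"
  shows "integrable P (\<lambda>\<omega>. f (X i \<omega>)) \<longleftrightarrow> integrable P (\<lambda>\<omega>. f (\<xi> \<omega>))"
  using integrable_distr_eq[of "X i" P borel f] integrable_distr_eq[of \<xi> P borel f]
    X_measurable[OF assms(1)] distr_eq[OF assms(1)] by simp

lemma prob_X_greater: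
  assumes "i \<in> {1..n}"
  shows "prob {\<omega>\<in>space P. t < \<bar>x i * X i \<omega>\<bar>} = F (t / x i)"
proof -
  have [measurable]: "X i \<in> borel_measurable P" using X_measurable assms .
  have "{\<omega>\<in>space P. t < \<bar>x i * X i \<omega>\<bar>} = X i -` {y. t / x i < \<bar>y\<bar>} \<inter> space P"
    using x_pos[OF assms] by (auto simp: field_simps abs_mult)
  then have "prob {\<omega>\<in>space P. t < \<bar>x i * X i \<omega>\<bar>} = measure (distr P borel (X i)) {y. t / x i < \<bar>y\<bar>}"
    by (subst measure_distr) auto
  also have "\<dots> = measure (distr P borel \<xi>) {y. t / x i < \<bar>y\<bar>}"
    using distr_eq[OF assms] by simp
  also have "\<dots> = F (t / x i)"
    by (subst measure_distr) (auto simp: tail_prob_def intro!: arg_cong[where f = prob])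
  finally show ?thesis .
qed

lemma F_quot_bounds:
  assumes "i \<in> {1..n}" "0 \<le> t"
  shows "0 < F (t / x i)" "F (t / x i) \<le> 1" "0 \<le> N (t / x i)" "F (t / x i) = exp (- N (t / x i))"
  using assms x_pos[OF assms(1)] by (auto intro: F_pos F_le_1 N_nonneg F_eq_exp)

lemma cnt_measurable:
  assumes "I \<subseteq> {1..n}"
  shows "cnt I t \<in> measurable P (count_space UNIV)"
  unfolding cnt_def using assms finite_subset[OF assms]
  by (intro measurable_card_greater aX_measurable) auto

lemma cnt_le: "finite I \<Longrightarrow> cnt I t \<omega> \<le> card I"
  unfolding cnt_def by (rule card_mono) auto

lemma cnt_mono: "I \<subseteq> J \<Longrightarrow> finite J \<Longrightarrow> cnt I t \<omega> \<le> cnt J t \<omega>"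
  unfolding cnt_def by (intro card_mono) auto

text \<open>The power factorises: each index contributes \<open>w\<close> or 1 according to whether
  it exceeds \<open>t\<close>, and these factors are functions of the independent
  \<open>X i\<close>.\<close>

lemma power_cnt_moment:
  assumes "I \<subseteq> {1..n}" "0 \<le> w"
  shows "integrable P (\<lambda>\<omega>. w ^ cnt I t \<omega>)"
    and "expectation (\<lambda>\<omega>. w ^ cnt I t \<omega>) = (\<Prod>i\<in>I. 1 + (w - 1) * F (t / x i))"
proof -
  define g where "g i y = (if t < \<bar>x i * y\<bar> then w else 1)" for i and y :: real
  have [measurable]: "g i \<in> borel_measurable borel" for i unfolding g_def by measurable
  have fin: "finite I" using assms(1) by (rule finite_subset) simp
  have pow: "w ^ cnt I t \<omega> = (\<Prod>i\<in>I. g i (X i \<omega>))" for \<omega>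
    using fin by (simp add: cnt_def g_def prod.If_cases Int_def)
  have ind: "indep_vars (\<lambda>_. borel) (\<lambda>i \<omega>. g i (X i \<omega>)) I"
    by (rule indep_vars_compose2[OF indep_vars_subset[OF indep assms(1)]]) simp
  have g_eq: "g i (X i \<omega>) = 1 + (w - 1) * indicator {\<omega>\<in>space P. t < \<bar>x i * X i \<omega>\<bar>} \<omega>"
    if "\<omega> \<in> space P" for i \<omega>
    using that by (auto simp: g_def indicator_def)
  have ev: "{\<omega>\<in>space P. t < \<bar>x i * X i \<omega>\<bar>} \<in> events" if "i \<in> I" for i
    using aX_measurable[of i] that assms(1) by (auto simp: borel_measurable_iff_greater)
  have int: "integrable P (\<lambda>\<omega>. g i (X i \<omega>))" if "i \<in> I" for i
    by (subst Bochner_Integration.integrable_cong[OF refl g_eq])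
      (auto simp: ev that emeasure_eq_measure simp del: indicator_simps)
  have g_exp: "expectation (\<lambda>\<omega>. g i (X i \<omega>)) = 1 + (w - 1) * F (t / x i)" if "i \<in> I" for i
  proof -
    have "expectation (\<lambda>\<omega>. g i (X i \<omega>))
        = expectation (\<lambda>\<omega>. 1 + (w - 1) * indicator {\<omega>\<in>space P. t < \<bar>x i * X i \<omega>\<bar>} \<omega>)"
      by (rule Bochner_Integration.integral_cong[OF refl g_eq])
    also have "\<dots> = 1 + (w - 1) * prob {\<omega>\<in>space P. t < \<bar>x i * X i \<omega>\<bar>}"
      using ev[OF that] by (simp add: emeasure_eq_measure prob_space del: indicator_simps)
    finally show ?thesis using prob_X_greater that assms(1) by auto
  qed
  show "integrable P (\<lambda>\<omega>. w ^ cnt I t \<omega>)"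
    unfolding pow by (rule indep_vars_integrable[OF fin ind int])
  show "expectation (\<lambda>\<omega>. w ^ cnt I t \<omega>) = (\<Prod>i\<in>I. 1 + (w - 1) * F (t / x i))"
    unfolding pow by (subst indep_vars_lebesgue_integral[OF fin ind int]) (simp_all add: g_exp)
qed

lemma cnt_events:
  assumes "I \<subseteq> {1..n}"
  shows "{\<omega>\<in>space P. Q (cnt I t \<omega>)} \<in> events"
proof -
  have [measurable]: "cnt I t \<in> measurable P (count_space UNIV)" by (rule cnt_measurable[OF assms])
  show ?thesis by measurable
qed

text \<open>Markov's inequality for \<open>w ^ cnt\<close>, which is at least \<open>w ^ r\<close>
  on the event because \<open>w \<ge> 1\<close>. In \<open>chernoff_lower\<close>,
  \<open>w \<le> 1\<close> makes small counts the favoured ones.\<close>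

lemma chernoff_upper:
  assumes "I \<subseteq> {1..n}" "1 \<le> w"
  shows "w ^ r * prob {\<omega>\<in>space P. r \<le> cnt I t \<omega>} \<le> (\<Prod>i\<in>I. 1 + (w - 1) * F (t / x i))"
  using assms by (subst power_cnt_moment(2)[symmetric])
    (auto intro!: mult_prob_le_expectation power_cnt_moment cnt_events power_increasing)

lemma chernoff_lower:
  assumes "I \<subseteq> {1..n}" "0 \<le> w" "w \<le> 1"
  shows "w ^ r * prob {\<omega>\<in>space P. cnt I t \<omega> \<le> r} \<le> (\<Prod>i\<in>I. 1 + (w - 1) * F (t / x i))"
  using assms by (subst power_cnt_moment(2)[symmetric])
    (auto intro!: mult_prob_le_expectation power_cnt_moment cnt_events power_decreasing)

lemma less_Kmax_iff: "k \<le> m \<Longrightarrow> t < Kmax m \<omega> \<longleftrightarrow> k \<le> cnt {1..m} t \<omega>"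
  unfolding Kmax_def cnt_def using k_gt_1 by (intro k_max_map_greater_iff) auto

lemma Kmax_nonneg: "k \<le> m \<Longrightarrow> 0 \<le> Kmax m \<omega>"
  unfolding Kmax_def using k_gt_1 by (intro k_max_nonneg) auto

lemma Kmax_measurable: "k \<le> m \<Longrightarrow> m \<le> n \<Longrightarrow> Kmax m \<in> borel_measurable P"
  unfolding Kmax_def using k_gt_1 by (intro borel_measurable_k_max aX_measurable) auto

lemma integrable_X: "i \<in> {1..n} \<Longrightarrow> integrable P (X i)"
  using integrable_X_iff[of i "\<lambda>y. y"] integrable_\<xi> by simp

lemma integrable_Kmax: "integrable P (Kmax m)" if "k \<le> m" "m \<le> n"
proof (rule Bochner_Integration.integrable_bound)
  show "integrable P (\<lambda>\<omega>. \<Sum>i\<in>{1..m}. \<bar>x i * X i \<omega>\<bar>)"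
    using that integrable_X by (intro Bochner_Integration.integrable_sum) auto
  show "AE \<omega> in P. norm (Kmax m \<omega>) \<le> norm (\<Sum>i\<in>{1..m}. \<bar>x i * X i \<omega>\<bar>)"
  proof (rule AE_I2)
    fix \<omega>
    have "Kmax m \<omega> \<le> (\<Sum>i\<in>{1..m}. \<bar>x i * X i \<omega>\<bar>)"
      unfolding Kmax_def using that k_gt_1 by (intro k_max_le_sum) auto
    with Kmax_nonneg[OF that(1), of \<omega>]
    show "norm (Kmax m \<omega>) \<le> norm (\<Sum>i\<in>{1..m}. \<bar>x i * X i \<omega>\<bar>)" by simp
  qed
qed (use Kmax_measurable that in auto)

section \<open>From probability one half to bounds on the expectation\<close>

lemma k_le_n: "k \<le> n"
  using k0_le by simp

lemma prob_half_imp: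
  assumes "0 \<le> t" "1 / 2 \<le> prob {\<omega>\<in>space P. t < Kmax n \<omega>}"
  shows "t / 2 \<le> expectation (Kmax n)"
proof -
  have "{\<omega>\<in>space P. t < Kmax n \<omega>} \<in> events"
    using Kmax_measurable[OF k_le_n] by (auto simp: borel_measurable_iff_greater)
  then have "t * prob {\<omega>\<in>space P. t < Kmax n \<omega>} \<le> expectation (Kmax n)"
    using k_le_n by (intro mult_prob_le_expectation integrable_Kmax Kmax_nonneg) auto
  with mult_left_mono[OF assms(2,1)] show ?thesis by simp
qed

lemma prob_half_of_cnt:
  assumes "I \<subseteq> {1..n}" "prob {\<omega>\<in>space P. cnt I t \<omega> \<le> k - 1} \<le> 1 / 2"
  shows "1 / 2 \<le> prob {\<omega>\<in>space P. t < Kmax n \<omega>}"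
proof -
  have meas: "{\<omega>\<in>space P. t < Kmax n \<omega>} \<in> events"
    using Kmax_measurable[OF k_le_n] by (auto simp: borel_measurable_iff_greater)
  have "\<omega> \<in> {\<omega>\<in>space P. cnt I t \<omega> \<le> k - 1}"
    if "\<omega> \<in> space P - {\<omega>\<in>space P. t < Kmax n \<omega>}" for \<omega>
    using that cnt_mono[OF assms(1), of t \<omega>] less_Kmax_iff[OF k_le_n, of t \<omega>] by auto
  then have "prob (space P - {\<omega>\<in>space P. t < Kmax n \<omega>}) \<le> prob {\<omega>\<in>space P. cnt I t \<omega> \<le> k - 1}"
    by (intro finite_measure_mono cnt_events[OF assms(1)]) auto
  with assms(2) prob_compl[OF meas] show ?thesis by linarith
qed

text \<open>At most \<open>k - 1\<close> exceedances among \<open>k + l\<close> variables means that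
  at least \<open>l + 1\<close> of them stay at or below \<open>t\<close>, which is unlikely when
  the sum of log tails is small compared with \<open>l + 1\<close>.\<close>

lemma prob_half_of_log_tail:
  assumes "k + l \<le> n" "0 \<le> t" and sum: "(\<Sum>i\<in>{1..k + l}. N (t / x i)) \<le> (real l + 1) / (2 * exp 1)"
  shows "1 / 2 \<le> prob {\<omega>\<in>space P. t < Kmax n \<omega>}"
proof (rule prob_half_of_cnt)
  \<comment> \<open>This value gives \<open>w * exp 1 = 1 / 2\<close>, and \<open>1 / w\<close>
    cancels the denominator in the assumption.\<close>
  define w :: real where "w = 1 / (2 * exp 1)"
  have e: "1 \<le> 2 * exp (1::real)" using exp_ge_add_one_self[of 1] by linarith
  have w: "0 < w" "w \<le> 1" using e by (auto simp: w_def)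
  show I: "{1..k + l} \<subseteq> {1..n}" using assms by auto
  define p where "p = prob {\<omega>\<in>space P. cnt {1..k + l} t \<omega> \<le> k - 1}"
  have "w ^ (k - 1) * p \<le> (\<Prod>i\<in>{1..k + l}. 1 + (w - 1) * F (t / x i))"
    unfolding p_def using w by (intro chernoff_lower I) auto
  also have "\<dots> \<le> (\<Prod>i\<in>{1..k + l}. w * exp ((2 * exp 1 - 1) * N (t / x i)))"
  proof (intro prod_mono conjI)
    fix i assume "i \<in> {1..k + l}"
    then have i: "i \<in> {1..n}" using I by auto
    note b = F_quot_bounds[OF i \<open>0 \<le> t\<close>]
    have "(1 - w) * F (t / x i) \<le> 1 * 1" using w b by (intro mult_mono) auto
    then show "0 \<le> 1 + (w - 1) * F (t / x i)" by (simp add: algebra_simps)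
    \<comment> \<open>Passes from \<open>F\<close> to \<open>N\<close> by
      \<open>1 - exp (- y) \<le> y\<close>.\<close>
    have "1 - F (t / x i) \<le> N (t / x i)"
      using b(4) exp_ge_add_one_self[of "- N (t / x i)"] by linarith
    then have "1 + (2 * exp 1 - 1) * (1 - F (t / x i)) \<le> 1 + (2 * exp 1 - 1) * N (t / x i)"
      using e by (intro add_left_mono mult_left_mono) auto
    also have "\<dots> \<le> exp ((2 * exp 1 - 1) * N (t / x i))" by (rule exp_ge_add_one_self)
    finally have "w * (1 + (2 * exp 1 - 1) * (1 - F (t / x i))) \<le> w * exp ((2 * exp 1 - 1) * N (t / x i))"
      using w by (intro mult_left_mono) auto
    moreover have "w * (1 + (2 * exp 1 - 1) * (1 - F (t / x i))) = 1 + (w - 1) * F (t / x i)"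
      by (simp add: w_def field_simps)
    ultimately show "1 + (w - 1) * F (t / x i) \<le> w * exp ((2 * exp 1 - 1) * N (t / x i))" by simp
  qed
  also have "\<dots> = w ^ (k + l) * exp ((2 * exp 1 - 1) * (\<Sum>i\<in>{1..k + l}. N (t / x i)))"
    by (simp add: prod.distrib exp_sum sum_distrib_left)
  also have "\<dots> \<le> w ^ (k + l) * exp (real (l + 1))"
  proof -
    have "(2 * exp 1 - 1) * (\<Sum>i\<in>{1..k + l}. N (t / x i))
        \<le> (2 * exp 1 - 1) * ((real l + 1) / (2 * exp 1))"
      using sum e by (intro mult_left_mono) auto
    also have "\<dots> \<le> (2 * exp 1) * ((real l + 1) / (2 * exp 1))"
      by (intro mult_right_mono) auto
    finally show ?thesis using w by (intro mult_left_mono) auto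
  qed
  also have "\<dots> = w ^ (k - 1) * (w * exp 1) ^ (l + 1)"
  proof -
    \<comment> \<open>\<open>k - 1\<close> factors \<open>w\<close> cancel against the left side;
      each of the other \<open>l + 1\<close> meets one factor \<open>exp 1\<close>.\<close>
    have "k + l = (k - 1) + (l + 1)" using k_gt_1 by simp
    then have "w ^ (k + l) = w ^ (k - 1) * w ^ (l + 1)" by (metis power_add)
    moreover have "exp (real (l + 1)) = exp 1 ^ (l + 1)" using exp_of_nat_mult[of "l + 1" "1::real"] by simp
    ultimately show ?thesis by (simp only: power_mult_distrib mult.assoc)
  qed
  finally have "p \<le> (w * exp 1) ^ (l + 1)" using w by simp
  also have "w * exp 1 = 1 / 2" by (simp add: w_def)
  also have "(1 / 2) ^ (l + 1) \<le> (1 / 2 :: real) ^ 1" by (rule power_decreasing) auto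
  finally show "p \<le> 1 / 2" by simp
qed

text \<open>Chernoff's bound at \<open>w = 1 / 4\<close> gives
  \<open>(4 * exp (- 3)) ^ (k - 1)\<close>, and \<open>exp 1 \<ge> 2\<close> makes the base at most
  1/2.\<close>

lemma prob_half_of_mean:
  assumes "I \<subseteq> {1..n}" "0 \<le> t" and mean: "4 * (real k - 1) \<le> (\<Sum>i\<in>I. F (t / x i))"
  shows "1 / 2 \<le> prob {\<omega>\<in>space P. t < Kmax n \<omega>}"
proof (rule prob_half_of_cnt[OF assms(1)])
  define p where "p = prob {\<omega>\<in>space P. cnt I t \<omega> \<le> k - 1}"
  have "(1 / 4) ^ (k - 1) * p \<le> (\<Prod>i\<in>I. 1 + (1 / 4 - 1) * F (t / x i))"
    unfolding p_def by (intro chernoff_lower assms(1)) auto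
  also have "\<dots> \<le> (\<Prod>i\<in>I. exp ((1 / 4 - 1) * F (t / x i)))"
  proof (intro prod_mono conjI)
    fix i assume "i \<in> I"
    show "0 \<le> 1 + (1 / 4 - 1) * F (t / x i)"
      using F_le_1[of "t / x i"] by simp
  qed (rule exp_ge_add_one_self)
  also have "\<dots> = exp ((1 / 4 - 1) * (\<Sum>i\<in>I. F (t / x i)))"
    using finite_subset[OF assms(1)] by (simp add: exp_sum sum_distrib_left del: minus_divide_left)
  also have "\<dots> \<le> exp (real (k - 1) * (- 3))"
    using mean k_gt_1 by (simp add: of_nat_diff)
  also have "\<dots> = exp (- 3) ^ (k - 1)" by (rule exp_of_nat_mult)
  finally have "p \<le> (4 * exp (- 3)) ^ (k - 1)"
    by (simp add: power_mult_distrib power_one_over field_simps)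
  also have "\<dots> \<le> (1 / 2) ^ (k - 1)"
  proof (intro power_mono)
    have "(2::real) ^ 3 \<le> exp 1 ^ 3"
      using exp_ge_add_one_self[of "1::real"] by (intro power_mono) auto
    also have "\<dots> = exp 3" by (simp add: exp_of_nat_mult[symmetric])
    finally show "4 * exp (- 3) \<le> (1 / 2 :: real)" by (simp add: exp_minus field_simps)
  qed simp
  also have "\<dots> \<le> (1 / 2 :: real) ^ 1" using k_gt_1 by (intro power_decreasing) auto
  finally show "p \<le> 1 / 2" by simp
qed

subsection \<open>Lower estimate\<close>

abbreviation k\<^sub>0 where "k\<^sub>0 \<equiv> k0 P \<xi> k"

text \<open>The quotient is at least 4 because \<open>F 1 \<le> 1\<close> and
  \<open>k \<ge> 2\<close>, so \<open>nat\<close> in \<open>k0\<close> truncates nothing.\<close>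

lemma k0_bounds:
  shows "4 * (real k - 1) / F 1 < real k\<^sub>0 + 1" "real k\<^sub>0 \<le> 4 * (real k - 1) / F 1" "4 \<le> k\<^sub>0"
proof -
  have F1: "0 < F 1" "F 1 \<le> 1" using F_pos[of 1] F_le_1[of 1] by auto
  have "4 * F 1 \<le> 4 * (real k - 1)" using F1 k_gt_1 by auto
  then have ge: "4 \<le> 4 * (real k - 1) / F 1" using F1 by (simp add: field_simps)
  have eq: "real k\<^sub>0 = real_of_int \<lfloor>4 * (real k - 1) / F 1\<rfloor>"
    using ge unfolding k0_def by (subst of_nat_nat) auto
  show "4 * (real k - 1) / F 1 < real k\<^sub>0 + 1" "real k\<^sub>0 \<le> 4 * (real k - 1) / F 1"
    unfolding eq by linarith+
  have "4 \<le> \<lfloor>4 * (real k - 1) / F 1\<rfloor>" using ge by (simp add: le_floor_iff)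
  then show "4 \<le> k\<^sub>0" unfolding k0_def by linarith
qed

definition tail_dilation :: real where
  "tail_dilation = 1 + ln (8 * (real k - 1)) / N 1"

lemma tail_dilation_ge_1: "1 \<le> tail_dilation"
  using k_gt_1 N_1_pos by (auto simp: tail_dilation_def)

text \<open>\<open>N u \<ge> N 1\<close> turns the extra multiple of \<open>N u\<close> in
  \<open>tail_dilation * N u\<close> into at least \<open>ln (8 * (k - 1))\<close>. The first bound
  is what \<open>tail_orlicz_le_tail\<close> requires.\<close>

lemma tail_dilation_F:
  assumes "1 \<le> u"
  shows "ln 8 \<le> N (tail_dilation * u)" "F (tail_dilation * u) \<le> F u / (8 * (real k - 1))"
proof -
  have "ln (8 * (real k - 1)) / N 1 * N 1 \<le> ln (8 * (real k - 1)) / N 1 * N u"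
    using assms N_mono[of 1 u] N_1_pos k_gt_1 by (intro mult_left_mono) auto
  then have "N u + ln (8 * (real k - 1)) \<le> tail_dilation * N u"
    using N_1_pos by (simp add: tail_dilation_def algebra_simps)
  also have "\<dots> \<le> N (tail_dilation * u)"
    using assms tail_dilation_ge_1 by (intro N_scale_ge) auto
  finally have *: "N u + ln (8 * (real k - 1)) \<le> N (tail_dilation * u)" .
  have "ln 8 \<le> ln (8 * (real k - 1))" using k_gt_1 by simp
  with * N_nonneg[of u] assms show "ln 8 \<le> N (tail_dilation * u)" by linarith
  have "F (tail_dilation * u) \<le> exp (- (N u + ln (8 * (real k - 1))))"
    using * assms tail_dilation_ge_1 by (subst F_eq_exp) auto
  also have "\<dots> = F u / (8 * (real k - 1))"
    using assms k_gt_1 by (simp add: F_eq_exp exp_diff)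
  finally show "F (tail_dilation * u) \<le> F u / (8 * (real k - 1))" .
qed

lemma tail_indices: "i \<in> {k + k\<^sub>0..n} \<Longrightarrow> i \<in> {1..n}"
  using k_gt_1 by auto

lemma sum_tail_orlicz_le_1:
  assumes "0 < t" and low: "prob {\<omega>\<in>space P. t / tail_dilation < Kmax n \<omega>} < 1 / 2"
  shows "(\<Sum>i\<in>{k + k\<^sub>0..n}. tail_orlicz P \<xi> (x i / t)) \<le> 1"
proof -
  define s where "s = t / tail_dilation"
  have "0 < s" using assms tail_dilation_ge_1 by (auto simp: s_def)
  have t_eq: "t = tail_dilation * s" using tail_dilation_ge_1 by (simp add: s_def)
  \<comment> \<open>Contrapositive of \<open>prob_half_of_mean\<close>, applied below both to the
    first \<open>k + k\<^sub>0 - 1\<close> indices and to the remaining ones.\<close>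
  have mean: "(\<Sum>i\<in>I. F (s / x i)) < 4 * (real k - 1)" if "I \<subseteq> {1..n}" for I
  proof (rule ccontr)
    assume "\<not> (\<Sum>i\<in>I. F (s / x i)) < 4 * (real k - 1)"
    then have "1 / 2 \<le> prob {\<omega>\<in>space P. s < Kmax n \<omega>}"
      using \<open>0 < s\<close> by (intro prob_half_of_mean[OF that]) auto
    with low show False by (simp add: s_def)
  qed
  let ?m = "k + k\<^sub>0"
  have m: "?m \<in> {1..n}" using k0_le k_gt_1 by auto
  \<comment> \<open>Otherwise \<open>k + k\<^sub>0 - 1\<close> indices have tail at least
    \<open>F 1\<close> each, and \<open>k\<^sub>0 + 1\<close> such indices already reach the mean
    \<open>4 * (k - 1)\<close>.\<close>
  have "x ?m < s"
  proof (rule ccontr)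
    assume "\<not> x ?m < s"
    then have s_le: "s \<le> x ?m" by simp
    have "F 1 \<le> F (s / x i)" if "i \<in> {1..?m - 1}" for i
    proof -
      have i: "i \<in> {1..n}" using that k0_le by auto
      have "x ?m \<le> x i" using that k0_le by (intro x_le) auto
      with s_le have "s \<le> x i" by simp
      then show ?thesis using \<open>0 < s\<close> x_pos[OF i] by (intro F_antimono) auto
    qed
    then have "(\<Sum>i\<in>{1..?m - 1}. F 1) \<le> (\<Sum>i\<in>{1..?m - 1}. F (s / x i))" by (rule sum_mono)
    also have "\<dots> < 4 * (real k - 1)" using k0_le by (intro mean) auto
    finally have "real (?m - 1) * F 1 < 4 * (real k - 1)"
      using k_gt_1 by (simp add: of_nat_diff)
    moreover have "4 * (real k - 1) \<le> real (?m - 1) * F 1"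
    proof -
      have "real k\<^sub>0 + 1 \<le> real (?m - 1)" using k_gt_1 by (simp add: of_nat_diff)
      with k0_bounds(1) have "4 * (real k - 1) / F 1 \<le> real (?m - 1)" by linarith
      then show ?thesis using F_pos[of 1] by (simp add: field_simps)
    qed
    ultimately show False by linarith
  qed
  have ge1: "1 \<le> s / x i" if "i \<in> {?m..n}" for i
  proof -
    have "x i \<le> x ?m" using that k_gt_1 by (intro x_le) auto
    with \<open>x ?m < s\<close> x_pos[OF tail_indices[OF that]] show ?thesis by simp
  qed
  \<comment> \<open>The 8/7 of the geometric series and the 1/8 of the dilation combine to 1/7; the
    total is then at most 4/7.\<close>
  have "(\<Sum>i\<in>{?m..n}. tail_orlicz P \<xi> (x i / t)) \<le> (\<Sum>i\<in>{?m..n}. F (s / x i) / (7 * (real k - 1)))"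
  proof (rule sum_mono)
    fix i assume i: "i \<in> {?m..n}"
    have "tail_orlicz P \<xi> (1 / (t / x i)) \<le> 8 / 7 * F (t / x i)"
      using tail_dilation_F(1)[OF ge1[OF i]] \<open>0 < t\<close> x_pos[OF tail_indices[OF i]]
      by (intro tail_orlicz_le_tail) (auto simp: t_eq)
    also have "F (t / x i) \<le> F (s / x i) / (8 * (real k - 1))"
      using tail_dilation_F(2)[OF ge1[OF i]] by (simp add: t_eq)
    finally show "tail_orlicz P \<xi> (x i / t) \<le> F (s / x i) / (7 * (real k - 1))"
      using k_gt_1 by (simp add: field_simps)
  qed
  also have "\<dots> = (\<Sum>i\<in>{?m..n}. F (s / x i)) / (7 * (real k - 1))"
    by (rule sum_divide_distrib[symmetric])
  also have "\<dots> \<le> 4 * (real k - 1) / (7 * (real k - 1))"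
    using mean[of "{?m..n}"] tail_indices k_gt_1 by (intro divide_right_mono) (auto simp: less_imp_le subset_iff)
  also have "\<dots> \<le> 1" using k_gt_1 by (simp add: field_simps)
  finally show ?thesis .
qed

section \<open>The Orlicz norms as infima over sets of real numbers\<close>

definition orlicz_set :: "real set" where
  "orlicz_set = {\<rho>. 0 < \<rho> \<and> (\<Sum>i\<in>{k + k\<^sub>0..n}. tail_orlicz P \<xi> (x i / \<rho>)) \<le> 1}"

lemma sum_term_eq_Inf: "sum_term P \<xi> n k x = Inf orlicz_set"
proof -
  have "(\<Sum>i\<in>{k + k\<^sub>0..n}. ennreal (tail_orlicz P \<xi> (\<bar>x i\<bar> / \<rho>))) \<le> 1
      \<longleftrightarrow> (\<Sum>i\<in>{k + k\<^sub>0..n}. tail_orlicz P \<xi> (x i / \<rho>)) \<le> 1" if "0 < \<rho>" for \<rho>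
  proof -
    have nn: "0 \<le> tail_orlicz P \<xi> (x i / \<rho>)" if "i \<in> {k + k\<^sub>0..n}" for i
      using x_pos[OF tail_indices[OF that]] \<open>0 < \<rho>\<close> by (intro tail_orlicz_nonneg) auto
    have "(\<Sum>i\<in>{k + k\<^sub>0..n}. ennreal (tail_orlicz P \<xi> (\<bar>x i\<bar> / \<rho>)))
        = (\<Sum>i\<in>{k + k\<^sub>0..n}. ennreal (tail_orlicz P \<xi> (x i / \<rho>)))"
      using x_pos[OF tail_indices] by (intro sum.cong) (auto simp: abs_of_pos)
    also have "\<dots> = ennreal (\<Sum>i\<in>{k + k\<^sub>0..n}. tail_orlicz P \<xi> (x i / \<rho>))"
      by (rule sum_ennreal) (rule nn)
    finally show ?thesis by simp
  qed
  then show ?thesis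
    unfolding sum_term_def orlicz_norm_def orlicz_set_def by (intro arg_cong[where f = Inf]) auto
qed

lemma orlicz_set_bdd_below: "bdd_below orlicz_set"
  by (rule bdd_belowI[of _ 0]) (simp add: orlicz_set_def)

lemma orlicz_set_nonempty: "orlicz_set \<noteq> {}"
proof -
  define c where "c = expectation (\<lambda>\<omega>. \<bar>\<xi> \<omega>\<bar>)"
  have "0 \<le> c" by (simp add: c_def Bochner_Integration.integral_nonneg)
  have sum_nn: "0 \<le> (\<Sum>i\<in>{k + k\<^sub>0..n}. x i)"
    using x_pos[OF tail_indices] by (intro sum_nonneg) (auto simp: less_imp_le)
  \<comment> \<open>The tail bound \<open>s * c\<close> makes the sum at most
    \<open>(\<Sum>i. x i) * c / \<rho>\<close>; the summand 1 keeps \<open>\<rho>\<close>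
    positive.\<close>
  define \<rho> where "\<rho> = 1 + (\<Sum>i\<in>{k + k\<^sub>0..n}. x i) * c"
  have "0 < \<rho>" using sum_nn \<open>0 \<le> c\<close> by (simp add: \<rho>_def add_pos_nonneg)
  have "(\<Sum>i\<in>{k + k\<^sub>0..n}. tail_orlicz P \<xi> (x i / \<rho>)) \<le> (\<Sum>i\<in>{k + k\<^sub>0..n}. x i / \<rho> * c)"
    unfolding c_def using x_pos[OF tail_indices] \<open>0 < \<rho>\<close>
    by (intro sum_mono tail_orlicz_le) (auto simp: less_imp_le)
  also have "\<dots> = (\<Sum>i\<in>{k + k\<^sub>0..n}. x i) * c / \<rho>"
    by (simp add: sum_divide_distrib sum_distrib_right)
  also have "\<dots> \<le> 1" using \<open>0 < \<rho>\<close> by (simp add: \<rho>_def)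
  finally have "\<rho> \<in> orlicz_set" using \<open>0 < \<rho>\<close> by (simp add: orlicz_set_def)
  then show ?thesis by auto
qed

lemma sum_term_nonneg: "0 \<le> sum_term P \<xi> n k x"
  unfolding sum_term_eq_Inf using orlicz_set_nonempty
  by (intro cInf_greatest) (auto simp: orlicz_set_def)

lemma expectation_Kmax_nonneg: "k \<le> m \<Longrightarrow> 0 \<le> expectation (Kmax m)"
  by (intro Bochner_Integration.integral_nonneg Kmax_nonneg)

lemma sum_term_le:
  "inverse tail_dilation * sum_term P \<xi> n k x \<le> 2 * expectation (Kmax n)"
proof -
  have "sum_term P \<xi> n k x \<le> 2 * tail_dilation * expectation (Kmax n)"
  \<comment> \<open>Every \<open>t\<close> strictly above the bound belongs to
    \<open>orlicz_set\<close>; otherwise \<open>prob_half_imp\<close> at level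
    \<open>t / tail_dilation\<close> would contradict the strictness.\<close>
  proof (rule dense_ge)
    fix t assume t: "2 * tail_dilation * expectation (Kmax n) < t"
    have "0 < t"
      using t expectation_Kmax_nonneg[OF k_le_n] tail_dilation_ge_1
      by (smt (verit) mult_nonneg_nonneg)
    have "prob {\<omega>\<in>space P. t / tail_dilation < Kmax n \<omega>} < 1 / 2"
    proof (rule ccontr)
      assume "\<not> prob {\<omega>\<in>space P. t / tail_dilation < Kmax n \<omega>} < 1 / 2"
      then have "t / tail_dilation / 2 \<le> expectation (Kmax n)"
        using \<open>0 < t\<close> tail_dilation_ge_1 by (intro prob_half_imp) auto
      then show False using t tail_dilation_ge_1 by (simp add: field_simps)
    qed
    then have "t \<in> orlicz_set"
      using sum_tail_orlicz_le_1 \<open>0 < t\<close> by (simp add: orlicz_set_def)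
    then show "sum_term P \<xi> n k x \<le> t"
      unfolding sum_term_eq_Inf by (intro cInf_lower orlicz_set_bdd_below)
  qed
  then show ?thesis using tail_dilation_ge_1 by (simp add: field_simps)
qed

text \<open>\<open>1 / \<rho>\<close> is a level, so the inverse of the infimum is the supremum of
  the levels at which the log-tail sum is still small.\<close>

definition log_set :: "nat \<Rightarrow> real set" where
  "log_set l = {\<rho>. 0 < \<rho> \<and> (\<Sum>i\<in>{1..k + l}. N (1 / \<rho> / x i)) \<le> (real l + 1) / (2 * exp 1)}"

lemma max_term_eq: "max_term P \<xi> k x = (MAX l\<in>{0..k\<^sub>0 - 1}. inverse (Inf (log_set l)))"
  unfolding max_term_def
proof (rule arg_cong[where f = Max], rule image_cong[OF refl])
  fix l assume "l \<in> {0..k\<^sub>0 - 1}"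
  then have idx: "i \<in> {1..n}" if "i \<in> {1..k + l}" for i using that k0_le k0_bounds(3) by auto
  have "(\<Sum>i\<in>{1..k + l}. ennreal (2 * exp 1 / (real l + 1) * N (\<bar>1 / x i\<bar> / \<rho>))) \<le> 1
      \<longleftrightarrow> (\<Sum>i\<in>{1..k + l}. N (1 / \<rho> / x i)) \<le> (real l + 1) / (2 * exp 1)" if "0 < \<rho>" for \<rho>
  proof -
    have nn: "0 \<le> N (1 / \<rho> / x i)" if "i \<in> {1..k + l}" for i
      using x_pos[OF idx[OF that]] \<open>0 < \<rho>\<close> by (intro N_nonneg) auto
    have "(\<Sum>i\<in>{1..k + l}. ennreal (2 * exp 1 / (real l + 1) * N (\<bar>1 / x i\<bar> / \<rho>)))
        = (\<Sum>i\<in>{1..k + l}. ennreal (2 * exp 1 / (real l + 1) * N (1 / \<rho> / x i)))"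
      using x_pos[OF idx] by (intro sum.cong) (auto simp: mult.commute abs_of_pos)
    also have "\<dots> = ennreal (\<Sum>i\<in>{1..k + l}. 2 * exp 1 / (real l + 1) * N (1 / \<rho> / x i))"
      by (rule sum_ennreal) (intro mult_nonneg_nonneg nn, auto)
    also have "\<dots> = ennreal (2 * exp 1 / (real l + 1) * (\<Sum>i\<in>{1..k + l}. N (1 / \<rho> / x i)))"
      by (simp only: sum_distrib_left)
    finally show ?thesis by (simp add: field_simps)
  qed
  then show "inverse (orlicz_norm (\<lambda>s. ennreal (2 * exp 1 / (real l + 1) * N s)) {1..k + l} (\<lambda>i. 1 / x i))
      = inverse (Inf (log_set l))"
    unfolding orlicz_norm_def log_set_def by (intro arg_cong[where f = "\<lambda>S. inverse (Inf S)"]) auto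
qed

lemma log_set_nonempty:
  assumes "k + l \<le> n"
  shows "log_set l \<noteq> {}"
proof -
  define \<sigma> where "\<sigma> = (\<Sum>i\<in>{1..k + l}. 1 / x i)"
  have pos: "0 < 1 / x i" if "i \<in> {1..k + l}" for i using x_pos[of i] that assms by auto
  have "0 < \<sigma>" unfolding \<sigma>_def using pos k_gt_1 by (intro sum_pos) auto
  \<comment> \<open>\<open>\<rho> \<ge> \<sigma>\<close> keeps the arguments of \<open>N\<close> at
    most 1, where \<open>N\<close> lies below its chord; the second summand yields the bound for
    \<open>l = 0\<close>, the smallest one.\<close>
  define \<rho> where "\<rho> = \<sigma> + 2 * exp 1 * N 1 * \<sigma>"
  have "0 < \<rho>" using \<open>0 < \<sigma>\<close> N_1_pos by (simp add: \<rho>_def add_pos_pos)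
  have "\<sigma> \<le> \<rho>" using \<open>0 < \<sigma>\<close> N_1_pos by (simp add: \<rho>_def)
  have "(\<Sum>i\<in>{1..k + l}. N (1 / \<rho> / x i)) \<le> (\<Sum>i\<in>{1..k + l}. 1 / \<rho> / x i * N 1)"
  proof (rule sum_mono)
    fix i assume i: "i \<in> {1..k + l}"
    have "1 / x i \<le> \<sigma>"
      unfolding \<sigma>_def using i pos by (intro member_le_sum) (auto simp: less_imp_le)
    with \<open>\<sigma> \<le> \<rho>\<close> have "1 / x i \<le> \<rho>" by simp
    then have "1 / \<rho> / x i \<le> 1" using \<open>0 < \<rho>\<close> pos[OF i] by (simp add: field_simps)
    moreover have "0 \<le> 1 / \<rho> / x i" using pos[OF i] \<open>0 < \<rho>\<close> by simp
    ultimately show "N (1 / \<rho> / x i) \<le> 1 / \<rho> / x i * N 1"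
      using N_scale_le[of "1 / \<rho> / x i" 1] by simp
  qed
  also have "\<dots> = N 1 * \<sigma> / \<rho>"
    by (simp add: \<sigma>_def sum_distrib_left sum_divide_distrib mult.commute)
  also have "\<dots> \<le> 1 / (2 * exp 1)"
    using \<open>0 < \<rho>\<close> \<open>0 < \<sigma>\<close> by (simp add: \<rho>_def divide_simps)
  also have "\<dots> \<le> (real l + 1) / (2 * exp 1)" by (intro divide_right_mono) auto
  finally show ?thesis using \<open>0 < \<rho>\<close> by (auto simp: log_set_def)
qed

text \<open>The k-max exceeds each level \<open>1 / \<rho>\<close> from \<open>log_set\<close> with
  probability at least 1/2, so this level is at most twice the expectation. The positive lower bound
  allows inverting the infimum.\<close>

lemma log_set_bounds:
  assumes "k + l \<le> n"
  shows "0 < expectation (Kmax n)" "1 / (2 * expectation (Kmax n)) \<le> Inf (log_set l)"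
proof -
  have ge: "1 / \<rho> / 2 \<le> expectation (Kmax n)" if "\<rho> \<in> log_set l" for \<rho>
    using that prob_half_of_log_tail[OF assms, of "1 / \<rho>"]
    by (intro prob_half_imp) (auto simp: log_set_def)
  obtain \<rho> where \<rho>: "\<rho> \<in> log_set l" using log_set_nonempty[OF assms] by auto
  then have "0 < 1 / \<rho> / 2" by (simp add: log_set_def)
  with ge[OF \<rho>] show E: "0 < expectation (Kmax n)" by linarith
  show "1 / (2 * expectation (Kmax n)) \<le> Inf (log_set l)"
  proof (rule cInf_greatest[OF log_set_nonempty[OF assms]])
    fix \<rho> assume "\<rho> \<in> log_set l"
    with ge[of \<rho>] E show "1 / (2 * expectation (Kmax n)) \<le> \<rho>"
      by (simp add: log_set_def field_simps)
  qed
qed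

lemma index_range: "l \<le> k\<^sub>0 - 1 \<Longrightarrow> k + l \<le> n"
  using k0_le k0_bounds(3) by simp

lemma max_term_le: "max_term P \<xi> k x \<le> 2 * expectation (Kmax n)"
proof -
  have "inverse (Inf (log_set l)) \<le> 2 * expectation (Kmax n)" if "l \<le> k\<^sub>0 - 1" for l
  proof -
    have "inverse (Inf (log_set l)) \<le> inverse (1 / (2 * expectation (Kmax n)))"
      using log_set_bounds[OF index_range[OF that]] by (intro le_imp_inverse_le) auto
    then show ?thesis by simp
  qed
  then show ?thesis unfolding max_term_eq by (subst Max_le_iff) auto
qed

text \<open>A level above \<open>max_term\<close> has its reciprocal below every infimum, hence
  outside every \<open>log_set l\<close>: the log-tail sums are large for all \<open>l\<close> at
  once.\<close>

lemma max_term_upper: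
  assumes "l \<le> k\<^sub>0 - 1"
  shows "0 < max_term P \<xi> k x"
    and "max_term P \<xi> k x < t \<Longrightarrow> (real l + 1) / (2 * exp 1) \<le> (\<Sum>i\<in>{1..k + l}. N (t / x i))"
proof -
  note b = log_set_bounds[OF index_range[OF assms]]
  then have pos: "0 < Inf (log_set l)" by (smt (verit) divide_pos_pos)
  have le: "inverse (Inf (log_set l)) \<le> max_term P \<xi> k x"
    unfolding max_term_eq using assms by (intro Max_ge) auto
  with pos show max_pos: "0 < max_term P \<xi> k x" by (smt (verit) positive_imp_inverse_positive)
  assume t: "max_term P \<xi> k x < t"
  then have "0 < t" using max_pos by simp
  have "inverse (Inf (log_set l)) < t" using le t by simp
  then have "1 / t < Inf (log_set l)" using pos \<open>0 < t\<close> by (simp add: field_simps)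
  then have "1 / t \<notin> log_set l"
    using cInf_lower[of "1 / t" "log_set l"] bdd_belowI[of "log_set l" 0]
    by (force simp: log_set_def)
  then show "(real l + 1) / (2 * exp 1) \<le> (\<Sum>i\<in>{1..k + l}. N (t / x i))"
    using \<open>0 < t\<close> by (simp add: log_set_def)
qed

text \<open>Both terms are at most twice the expectation, whence the factor 1/4.\<close>

lemma lower_estimate:
  "1 / 4 * (max_term P \<xi> k x + inverse (1 + ln (8 * (real k - 1)) / N 1) * sum_term P \<xi> n k x)
    \<le> expectation (Kmax n)"
  using max_term_le sum_term_le by (simp add: tail_dilation_def)

subsection \<open>Upper estimate\<close>

definition q :: nat where "q = k + k\<^sub>0 - 1"

lemma q_bounds: "k \<le> q" "q \<le> n" "3 \<le> q"
  using k0_bounds(3) k0_le k_gt_1 by (auto simp: q_def)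

lemma exceed_events:
  assumes "i \<in> {1..n}"
  shows "{\<omega>\<in>space P. t < \<bar>x i * X i \<omega>\<bar>} \<in> events"
  using aX_measurable[OF assms] by (auto simp: borel_measurable_iff_greater)

text \<open>Indices past \<open>r\<close> have \<open>b i \<ge> \<beta>\<close> and are paid for by
  the union bound, the first term. Up to \<open>r\<close> single values may be small, but their sum
  is large, and Chernoff's bound gives the second term.\<close>

lemma prob_cnt_le:
  fixes A D :: real
  defines "\<beta> \<equiv> 1 / (8 * exp 1)"
  assumes "0 < A" "1 \<le> D"
    and sums: "\<And>l. l \<le> k\<^sub>0 - 1 \<Longrightarrow> (real l + 1) / (2 * exp 1) \<le> (\<Sum>i\<in>{1..k + l}. N (A / x i))"
  shows "prob {\<omega>\<in>space P. k \<le> cnt {1..q} (D * A) \<omega>}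
    \<le> real q * exp (- (\<beta> * D)) + exp (real q * exp (- (\<beta> * D)) - 4 * \<beta> * D)"
proof -
  define b where "b i = N (A / x i)" for i
  \<comment> \<open>A quarter of the constant in \<open>sums\<close>, so that the sum over
    \<open>k + l\<close> indices is at least \<open>4 * \<beta> * (l + 1)\<close>.\<close>
  have \<beta>: "0 < \<beta>" "1 / (2 * exp 1) = 4 * \<beta>" by (auto simp: \<beta>_def)
  have b_nn: "0 \<le> b i" if "i \<in> {1..n}" for i
    unfolding b_def using x_pos[OF that] \<open>0 < A\<close> by (intro N_nonneg) auto
  have b_mono: "b i \<le> b j" if "1 \<le> i" "i \<le> j" "j \<le> n" for i j
    unfolding b_def using x_le[OF that] x_pos[of i] x_pos[of j] that \<open>0 < A\<close>
    by (intro N_mono divide_left_mono) auto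
  have F_le: "F (D * A / x i) \<le> exp (- (D * b i))" if "i \<in> {1..n}" for i
    using F_scale_le[of D "A / x i"] x_pos[OF that] assms by (simp add: b_def)
  \<comment> \<open>If \<open>R\<close> is empty, \<open>r = k - 1\<close> indices cannot produce \<open>k\<close> exceedances.\<close>
  define R where "R = {i\<in>{k..q}. b i < \<beta>}"
  define r where "r = Max (insert (k - 1) R)"
  have fin: "finite R" by (simp add: R_def)
  have r_in: "r \<in> insert (k - 1) R" unfolding r_def using fin by (intro Max_in) auto
  then have r_bounds: "k - 1 \<le> r" "r \<le> q" using q_bounds by (auto simp: R_def)
  have large: "\<beta> \<le> b i" if "i \<in> {r + 1..q}" for i
  proof (rule ccontr)
    assume "\<not> \<beta> \<le> b i"
    then have "i \<in> insert (k - 1) R" using that r_bounds(1) by (auto simp: R_def)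
    then have "i \<le> r" unfolding r_def using fin by (intro Max_ge) auto
    with that show False by simp
  qed
  let ?E = "\<lambda>i. {\<omega>\<in>space P. D * A < \<bar>x i * X i \<omega>\<bar>}"
  let ?C = "{\<omega>\<in>space P. k \<le> cnt {1..r} (D * A) \<omega>}"
  have sub: "{\<omega>\<in>space P. k \<le> cnt {1..q} (D * A) \<omega>} \<subseteq> (\<Union>i\<in>{r + 1..q}. ?E i) \<union> ?C"
  proof
    fix \<omega> assume \<omega>: "\<omega> \<in> {\<omega>\<in>space P. k \<le> cnt {1..q} (D * A) \<omega>}"
    show "\<omega> \<in> (\<Union>i\<in>{r + 1..q}. ?E i) \<union> ?C"
    proof (rule ccontr)
      assume *: "\<omega> \<notin> (\<Union>i\<in>{r + 1..q}. ?E i) \<union> ?C"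
      have "i \<le> r" if "i \<in> {1..q}" "D * A < \<bar>x i * X i \<omega>\<bar>" for i
        using * that \<omega> by (force simp: not_less_eq_eq)
      then have "{i\<in>{1..q}. D * A < \<bar>x i * X i \<omega>\<bar>} = {i\<in>{1..r}. D * A < \<bar>x i * X i \<omega>\<bar>}"
        using r_bounds by auto
      with \<omega> * show False by (simp add: cnt_def)
    qed
  qed
  have evE: "?E i \<in> events" if "i \<in> {r + 1..q}" for i
    using that q_bounds by (intro exceed_events) auto
  have r_sub: "{1..r} \<subseteq> {1..n}" using r_bounds q_bounds by auto
  have evC: "?C \<in> events" by (rule cnt_events[OF r_sub])
  have "prob {\<omega>\<in>space P. k \<le> cnt {1..q} (D * A) \<omega>} \<le> prob ((\<Union>i\<in>{r + 1..q}. ?E i) \<union> ?C)"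
    using sub evE evC by (intro finite_measure_mono) auto
  also have "\<dots> \<le> prob (\<Union>i\<in>{r + 1..q}. ?E i) + prob ?C"
    using evE evC by (intro measure_Un_le) auto
  also have "prob (\<Union>i\<in>{r + 1..q}. ?E i) \<le> (\<Sum>i\<in>{r + 1..q}. prob (?E i))"
    using evE by (intro finite_measure_subadditive_finite) auto
  also have "\<dots> \<le> (\<Sum>i\<in>{r + 1..q}. exp (- (\<beta> * D)))"
  proof (rule sum_mono)
    fix i assume i: "i \<in> {r + 1..q}"
    then have i': "i \<in> {1..n}" using q_bounds by auto
    have "prob (?E i) \<le> exp (- (D * b i))" using F_le[OF i'] prob_X_greater[OF i'] by simp
    also have "\<dots> \<le> exp (- (\<beta> * D))" using large[OF i] \<open>1 \<le> D\<close> by (simp add: mult.commute)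
    finally show "prob (?E i) \<le> exp (- (\<beta> * D))" .
  qed
  also have "\<dots> \<le> real q * exp (- (\<beta> * D))"
    by (simp add: mult_right_mono)
  also have "prob ?C \<le> exp (real q * exp (- (\<beta> * D)) - 4 * \<beta> * D)"
  proof (cases "k \<le> r")
    case False
    then have "\<not> k \<le> cnt {1..r} (D * A) \<omega>" for \<omega>
      using cnt_le[of "{1..r}" "D * A" \<omega>] by auto
    then show ?thesis by simp
  next
    case True
    then have br: "b r < \<beta>" using r_in k_gt_1 by (auto simp: R_def)
    obtain l where l: "r = k + l" using True by (auto simp: le_iff_add)
    have "l \<le> k\<^sub>0 - 1" using l r_bounds k0_bounds(3) by (simp add: q_def)
    note sum_b = sums[OF this, folded b_def l]
    \<comment> \<open>The \<open>l\<close> surplus factors \<open>w\<close> contribute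
      \<open>exp (2 * \<beta> * D * l)\<close>, which
      \<open>exp (- (4 * \<beta> * D * (l + 1)))\<close> from the sum more than absorbs.\<close>
    define w where "w = exp (2 * \<beta> * D)"
    have "1 \<le> w" using \<beta> \<open>1 \<le> D\<close> by (simp add: w_def)
    have "w ^ k * prob ?C \<le> (\<Prod>i\<in>{1..r}. 1 + (w - 1) * F (D * A / x i))"
      by (rule chernoff_upper[OF r_sub \<open>1 \<le> w\<close>])
    also have "\<dots> \<le> (\<Prod>i\<in>{1..r}. w * exp (- (D * b i)) * exp (exp (- (\<beta> * D))))"
    proof (intro prod_mono conjI)
      fix i assume i: "i \<in> {1..r}"
      then have i': "i \<in> {1..n}" using r_sub by auto
      have F_nn: "0 \<le> F (D * A / x i)" by (simp add: tail_prob_def)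
      then show "0 \<le> 1 + (w - 1) * F (D * A / x i)" using \<open>1 \<le> w\<close> by simp
      \<comment> \<open>Since \<open>b i < \<beta>\<close>, the summand 1 is at most a small
        multiple of \<open>w * exp (- (D * b i))\<close>.\<close>
      have "b i \<le> b r" using i r_bounds q_bounds by (intro b_mono) auto
      with br have "D * b i \<le> D * \<beta>" using \<open>1 \<le> D\<close> by (intro mult_left_mono) auto
      then have "1 \<le> exp (2 * \<beta> * D - D * b i - \<beta> * D)" by (simp add: algebra_simps)
      also have "\<dots> = w * exp (- (D * b i)) * exp (- (\<beta> * D))"
        by (simp add: w_def mult_exp_exp)
      finally have one: "1 \<le> w * exp (- (D * b i)) * exp (- (\<beta> * D))" .
      have "(w - 1) * F (D * A / x i) \<le> w * exp (- (D * b i))"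
        using F_le[OF i'] F_nn \<open>1 \<le> w\<close> by (intro mult_mono) auto
      with one have "1 + (w - 1) * F (D * A / x i) \<le> w * exp (- (D * b i)) * (1 + exp (- (\<beta> * D)))"
        by (simp add: algebra_simps)
      also have "\<dots> \<le> w * exp (- (D * b i)) * exp (exp (- (\<beta> * D)))"
        using \<open>1 \<le> w\<close> by (intro mult_left_mono exp_ge_add_one_self) auto
      finally show "1 + (w - 1) * F (D * A / x i) \<le> w * exp (- (D * b i)) * exp (exp (- (\<beta> * D)))" .
    qed
    also have "\<dots> = w ^ r * exp (- (D * (\<Sum>i\<in>{1..r}. b i))) * exp (real r * exp (- (\<beta> * D)))"
      by (simp add: prod.distrib exp_sum[symmetric] sum_negf sum_distrib_left exp_of_nat_mult)
    also have "\<dots> \<le> w ^ r * exp (- (D * (4 * \<beta> * (real l + 1)))) * exp (real q * exp (- (\<beta> * D)))"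
    proof (intro mult_mono mult_left_mono)
      have "4 * \<beta> * (real l + 1) = (real l + 1) / (2 * exp 1)" by (simp flip: \<beta>(2))
      with sum_b have "4 * \<beta> * (real l + 1) \<le> (\<Sum>i\<in>{1..r}. b i)" by (simp only: b_def)
      then show "exp (- (D * (\<Sum>i\<in>{1..r}. b i))) \<le> exp (- (D * (4 * \<beta> * (real l + 1))))"
        using \<open>1 \<le> D\<close> by simp
      show "exp (real r * exp (- (\<beta> * D))) \<le> exp (real q * exp (- (\<beta> * D)))"
        using r_bounds by (simp add: mult_right_mono)
    qed (use \<open>1 \<le> w\<close> in auto)
    also have "w ^ r = w ^ k * exp (real l * (2 * \<beta> * D))"
      by (simp add: l power_add w_def exp_of_nat_mult)
    finally have "w ^ k * prob ?C \<le> w ^ k * (exp (real l * (2 * \<beta> * D))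
        * exp (- (D * (4 * \<beta> * (real l + 1)))) * exp (real q * exp (- (\<beta> * D))))"
      by (simp only: mult.assoc)
    then have "prob ?C \<le> exp (real l * (2 * \<beta> * D))
        * exp (- (D * (4 * \<beta> * (real l + 1)))) * exp (real q * exp (- (\<beta> * D)))"
      using \<open>1 \<le> w\<close> by simp
    also have "\<dots> = exp (real q * exp (- (\<beta> * D)) - 4 * \<beta> * D - 2 * \<beta> * D * real l)"
      by (simp add: mult_exp_exp algebra_simps)
    also have "\<dots> \<le> exp (real q * exp (- (\<beta> * D)) - 4 * \<beta> * D)"
      using \<beta> \<open>1 \<le> D\<close> by simp
    finally show ?thesis .
  qed
  finally show ?thesis by simp
qed

lemma expectation_Kmax_q_le:
  "expectation (Kmax q) \<le> 16 * exp 1 * (ln q + 4) * max_term P \<xi> k x"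
proof -
  \<comment> \<open>The factor 2 makes \<open>A\<close> strictly larger than
    \<open>max_term\<close>, as \<open>max_term_upper\<close> demands.\<close>
  define A where "A = 2 * max_term P \<xi> k x"
  have M_pos: "0 < max_term P \<xi> k x" using max_term_upper(1)[of 0] by simp
  then have "0 < A" by (simp add: A_def)
  have sums: "(real l + 1) / (2 * exp 1) \<le> (\<Sum>i\<in>{1..k + l}. N (A / x i))" if "l \<le> k\<^sub>0 - 1" for l
    using M_pos by (intro max_term_upper(2)[OF that]) (simp add: A_def)
  have q_pos: "0 < real q" using q_bounds by simp
  have ln_q: "1 \<le> ln (real q)"
  proof -
    have "exp 1 \<le> real q" using exp_le q_bounds(3) by linarith
    then show ?thesis using q_pos by (simp add: ln_ge_iff)
  qed
  have e: "1 \<le> 8 * exp (1::real)" using exp_ge_add_one_self[of "1::real"] by linarith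
  \<comment> \<open>Then \<open>D j / (8 * exp 1) = ln q + j\<close>, so the union bound over
    \<open>q\<close> indices becomes \<open>exp (- j)\<close>.\<close>
  define D where "D j = 8 * exp 1 * (ln (real q) + real j)" for j
  have D_ge: "1 \<le> D j" for j
  proof -
    have "1 * 1 \<le> 8 * exp 1 * (ln (real q) + real j)"
      using ln_q e by (intro mult_mono) auto
    then show ?thesis by (simp add: D_def)
  qed
  have tail: "prob {\<omega>\<in>space P. 8 * exp 1 * ln (real q) * A + 8 * exp 1 * A * real j < Kmax q \<omega>}
      \<le> 2 * exp (- 1) ^ j" for j
  proof -
    have eq: "1 / (8 * exp 1) * D j = ln (real q) + real j" by (simp add: D_def)
    have qe: "real q * exp (- (ln (real q) + real j)) = exp (- real j)"
      using q_pos by (simp add: exp_diff exp_minus field_simps)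
    have "{\<omega>\<in>space P. 8 * exp 1 * ln (real q) * A + 8 * exp 1 * A * real j < Kmax q \<omega>}
        = {\<omega>\<in>space P. k \<le> cnt {1..q} (D j * A) \<omega>}"
      using less_Kmax_iff[OF q_bounds(1)] by (simp add: D_def algebra_simps)
    then have "prob {\<omega>\<in>space P. 8 * exp 1 * ln (real q) * A + 8 * exp 1 * A * real j < Kmax q \<omega>}
        \<le> exp (- real j) + exp (exp (- real j) - 4 * (ln (real q) + real j))"
      using prob_cnt_le[OF \<open>0 < A\<close> D_ge sums, of j] by (simp only: eq qe mult.assoc)
    also have "exp (exp (- real j) - 4 * (ln (real q) + real j)) \<le> exp (- real j)"
    proof -
      have *: "u - 4 * (v + y) \<le> - y" if "u \<le> 1" "1 \<le> v" "0 \<le> y" for u v y :: real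
        using that by simp
      show ?thesis using ln_q by (subst exp_le_cancel_iff) (intro *, auto)
    qed
    also have "exp (- real j) + exp (- real j) = 2 * exp (- 1) ^ j"
      by (simp add: exp_of_nat_mult[symmetric])
    finally show ?thesis by simp
  qed
  define S where "S = 2 * (1 / (1 - exp (- 1 :: real)))"
  have S_sums: "(\<lambda>j. 2 * exp (- 1) ^ j) sums S"
    unfolding S_def by (intro sums_mult geometric_sums) simp
  have "2 \<le> exp (1::real)" using exp_ge_add_one_self[of 1] by simp
  then have "exp (- 1) \<le> (1 / 2 :: real)" by (simp add: exp_minus field_simps)
  then have "S \<le> 4" by (simp add: S_def field_simps)
  have meas: "Kmax q \<in> borel_measurable P" using q_bounds by (intro Kmax_measurable)
  have c_pos: "0 < 8 * exp 1 * A" using \<open>0 < A\<close> by simp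
  note excess = expectation_excess_le[OF meas c_pos tail S_sums]
  have "expectation (Kmax q) \<le> expectation (\<lambda>\<omega>. 8 * exp 1 * ln (real q) * A
      + max 0 (Kmax q \<omega> - 8 * exp 1 * ln (real q) * A))"
    using q_bounds excess(1)
    by (intro integral_mono integrable_Kmax Bochner_Integration.integrable_add) auto
  also have "\<dots> = 8 * exp 1 * ln (real q) * A
      + expectation (\<lambda>\<omega>. max 0 (Kmax q \<omega> - 8 * exp 1 * ln (real q) * A))"
    using excess(1) by (simp add: prob_space)
  also have "\<dots> \<le> 8 * exp 1 * ln (real q) * A + 8 * exp 1 * A * S"
    using excess(2) by simp
  also have "\<dots> \<le> 8 * exp 1 * ln (real q) * A + 8 * exp 1 * A * 4"
    using \<open>S \<le> 4\<close> \<open>0 < A\<close> by simp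
  also have "\<dots> = 16 * exp 1 * (ln q + 4) * max_term P \<xi> k x"
    by (simp add: A_def algebra_simps)
  finally show ?thesis .
qed

text \<open>Equality of laws replaces \<open>X i\<close> by \<open>\<xi>\<close>, and homogeneity
  pulls \<open>\<rho>\<close> out of the excess.\<close>

lemma expectation_excess_X:
  assumes "i \<in> {k + k\<^sub>0..n}" "0 < \<rho>"
  shows "integrable P (\<lambda>\<omega>. max 0 (\<bar>x i * X i \<omega>\<bar> - \<rho>))"
    and "expectation (\<lambda>\<omega>. max 0 (\<bar>x i * X i \<omega>\<bar> - \<rho>)) = \<rho> * tail_orlicz P \<xi> (x i / \<rho>)"
proof -
  have i: "i \<in> {1..n}" using tail_indices assms(1) .
  have xi: "0 < x i" using x_pos i .
  show "integrable P (\<lambda>\<omega>. max 0 (\<bar>x i * X i \<omega>\<bar> - \<rho>))"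
    using integrable_X[OF i] by (intro integrable_max) auto
  have "expectation (\<lambda>\<omega>. max 0 (\<bar>x i * X i \<omega>\<bar> - \<rho>))
      = expectation (\<lambda>\<omega>. max 0 (\<bar>x i * \<xi> \<omega>\<bar> - \<rho>))"
    using i by (rule expectation_X[where f = "\<lambda>y. max 0 (\<bar>x i * y\<bar> - \<rho>)"]) measurable
  also have "\<dots> = expectation (\<lambda>\<omega>. \<rho> * max 0 (x i / \<rho> * \<bar>\<xi> \<omega>\<bar> - 1))"
  proof (rule Bochner_Integration.integral_cong[OF refl])
    fix \<omega>
    have "\<bar>x i * \<xi> \<omega>\<bar> - \<rho> = \<rho> * (x i / \<rho> * \<bar>\<xi> \<omega>\<bar> - 1)"
      using xi assms(2) by (simp add: abs_mult field_simps)
    then show "max 0 (\<bar>x i * \<xi> \<omega>\<bar> - \<rho>) = \<rho> * max 0 (x i / \<rho> * \<bar>\<xi> \<omega>\<bar> - 1)"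
      using assms(2) by (simp add: max_mult_distrib_left)
  qed
  also have "\<dots> = \<rho> * tail_orlicz P \<xi> (x i / \<rho>)"
    using xi assms(2) by (simp add: tail_orlicz_eq')
  finally show "expectation (\<lambda>\<omega>. max 0 (\<bar>x i * X i \<omega>\<bar> - \<rho>)) = \<rho> * tail_orlicz P \<xi> (x i / \<rho>)" .
qed

lemma expectation_Kmax_le:
  assumes "\<rho> \<in> orlicz_set"
  shows "expectation (Kmax n) \<le> expectation (Kmax q) + 2 * \<rho>"
proof -
  have \<rho>: "0 < \<rho>" "(\<Sum>i\<in>{k + k\<^sub>0..n}. tail_orlicz P \<xi> (x i / \<rho>)) \<le> 1"
    using assms by (auto simp: orlicz_set_def)
  have q1: "{q + 1..n} = {k + k\<^sub>0..n}" using k_gt_1 by (simp add: q_def)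
  let ?V = "\<lambda>\<omega>. \<rho> + (\<Sum>i\<in>{k + k\<^sub>0..n}. max 0 (\<bar>x i * X i \<omega>\<bar> - \<rho>))"
  have int: "integrable P (\<lambda>\<omega>. \<Sum>i\<in>{k + k\<^sub>0..n}. max 0 (\<bar>x i * X i \<omega>\<bar> - \<rho>))"
    by (intro Bochner_Integration.integrable_sum expectation_excess_X \<rho>)
  have intq: "integrable P (Kmax q)" using q_bounds by (intro integrable_Kmax)
  have "Kmax n \<omega> \<le> Kmax q \<omega> + ?V \<omega>" for \<omega>
    unfolding Kmax_def q1[symmetric]
    using k_gt_1 q_bounds \<rho> by (intro k_max_split_le) auto
  then have "expectation (Kmax n) \<le> expectation (\<lambda>\<omega>. Kmax q \<omega> + ?V \<omega>)"
    using int intq k_le_n q_bounds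
    by (intro integral_mono integrable_Kmax Bochner_Integration.integrable_add) auto
  also have "\<dots> = expectation (Kmax q) + (\<rho>
      + (\<Sum>i\<in>{k + k\<^sub>0..n}. expectation (\<lambda>\<omega>. max 0 (\<bar>x i * X i \<omega>\<bar> - \<rho>))))"
    using int intq expectation_excess_X(1) \<rho> by (simp add: prob_space)
  also have "\<dots> = expectation (Kmax q) + (\<rho> + \<rho> * (\<Sum>i\<in>{k + k\<^sub>0..n}. tail_orlicz P \<xi> (x i / \<rho>)))"
    using expectation_excess_X(2) \<rho> by (simp add: sum_distrib_left)
  also have "\<dots> \<le> expectation (Kmax q) + (\<rho> + \<rho> * 1)"
    using \<rho> by (intro add_left_mono mult_left_mono) auto
  finally show ?thesis by simp
qed

text \<open>\<open>q \<le> 5 * (k - 1) / F 1\<close> and \<open>ln (1 / F 1) = N 1\<close> bring in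
  \<open>N 1\<close>; as \<open>C\<close> and \<open>ln (k + 1)\<close> are at least 1, every
  summand is absorbed into their product.\<close>

lemma ln_q_le: "ln q + 4 \<le> 8 * (max (N 1) (1 / N 1) * ln (real k + 1))"
proof -
  define C where "C = max (N 1) (1 / N 1)"
  have "N 1 \<le> C" by (simp add: C_def)
  have "1 \<le> C"
  proof (cases "1 \<le> N 1")
    case False
    then have "1 \<le> 1 / N 1" using N_1_pos by simp
    then show ?thesis by (simp add: C_def)
  qed (simp add: C_def)
  have ln_k: "1 \<le> ln (real k + 1)"
  proof -
    have "exp 1 \<le> real k + 1" using exp_le k_gt_1 by linarith
    then show ?thesis using k_gt_1 by (subst ln_ge_iff) auto
  qed
  have F1: "0 < F 1" "F 1 \<le> 1" using F_pos[of 1] F_le_1[of 1] by auto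
  have "real k - 1 \<le> (real k - 1) / F 1"
    using divide_left_mono[of "F 1" 1 "real k - 1"] F1 k_gt_1 by simp
  moreover have "real q = real k + real k\<^sub>0 - 1" using k_gt_1 by (simp add: q_def of_nat_diff)
  ultimately have "real q \<le> 5 * (real k - 1) / F 1"
    using k0_bounds(2) unfolding times_divide_eq_right[symmetric] by linarith
  also have "\<dots> \<le> 5 * (real k + 1) / F 1" using F1 by (intro divide_right_mono) auto
  finally have "ln (real q) \<le> ln (5 * (real k + 1) / F 1)"
    using q_bounds F1 by (subst ln_le_cancel_iff) auto
  also have "\<dots> = ln 5 + ln (real k + 1) + N 1"
    using F1 by (simp add: ln_div ln_mult log_tail_def del: distrib_left_numeral)
  also have "ln (5::real) \<le> 2"
  proof -
    \<comment> \<open>\<open>exp 1 \<ge> 1 + 1 + 1 / 2 \<ge> 9 / 4\<close>, and the square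
      \<open>81 / 16\<close> exceeds 5.\<close>
    have "(9/4::real) ^ 2 \<le> exp 1 ^ 2"
    proof (rule power_mono)
      show "9 / 4 \<le> exp (1::real)"
        using exp_lower_Taylor_quadratic[of 1] by simp
    qed simp
    also have "exp 1 ^ 2 = exp (2::real)" by (simp add: exp_of_nat_mult[symmetric])
    finally have "5 \<le> exp (2::real)" by (simp add: power2_eq_square)
    then have "ln 5 \<le> ln (exp (2::real))" by (subst ln_le_cancel_iff) auto
    then show ?thesis by simp
  qed
  finally have "ln (real q) + 4 \<le> 6 + N 1 + ln (real k + 1)" by simp
  also have "\<dots> \<le> 6 * (C * ln (real k + 1)) + C * ln (real k + 1) + C * ln (real k + 1)"
  proof (intro add_mono)
    show "6 \<le> 6 * (C * ln (real k + 1))" using mult_mono[OF \<open>1 \<le> C\<close> ln_k] \<open>1 \<le> C\<close> by simp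
    show "N 1 \<le> C * ln (real k + 1)"
      using mult_mono[OF \<open>N 1 \<le> C\<close> ln_k] \<open>1 \<le> C\<close> by simp
    show "ln (real k + 1) \<le> C * ln (real k + 1)"
      using mult_right_mono[OF \<open>1 \<le> C\<close>, of "ln (real k + 1)"] ln_k by simp
  qed
  finally show ?thesis by (simp add: C_def mult.commute)
qed

text \<open>The constant is \<open>16 * exp 1\<close> from \<open>expectation_Kmax_q_le\<close>
  times 8 from \<open>ln_q_le\<close>; it also covers the factor 2 in front of
  \<open>sum_term\<close>.\<close>

lemma upper_estimate:
  "expectation (Kmax n) \<le> 128 * exp 1 *
    (max (N 1) (1 / N 1) * ln (real k + 1) * max_term P \<xi> k x + sum_term P \<xi> n k x)"
proof -
  let ?C = "max (N 1) (1 / N 1) * ln (real k + 1)"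
  let ?A = "max_term P \<xi> k x"
  have A_pos: "0 < ?A" using max_term_upper(1)[of 0] by simp
  have "(expectation (Kmax n) - expectation (Kmax q)) / 2 \<le> Inf orlicz_set"
    using expectation_Kmax_le by (intro cInf_greatest orlicz_set_nonempty) (auto simp: field_simps)
  then have "expectation (Kmax n) \<le> expectation (Kmax q) + 2 * sum_term P \<xi> n k x"
    by (simp add: sum_term_eq_Inf)
  also have "expectation (Kmax q) \<le> 16 * exp 1 * (ln q + 4) * ?A" by (rule expectation_Kmax_q_le)
  also have "\<dots> \<le> 16 * exp 1 * (8 * ?C) * ?A"
    using ln_q_le A_pos by (intro mult_right_mono mult_left_mono) auto
  also have "2 * sum_term P \<xi> n k x \<le> 128 * exp 1 * sum_term P \<xi> n k x"
  proof (rule mult_right_mono[OF _ sum_term_nonneg])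
    show "2 \<le> 128 * exp (1::real)" using exp_ge_add_one_self[of "1::real"] by linarith
  qed
  finally show ?thesis by (simp add: algebra_simps)
qed

end

section \<open>The two estimates on an arbitrary sample space\<close>

lemma admissible_constant_universal: "admissible_constant TYPE('a) (128 * exp 1)"
  unfolding admissible_constant_def Let_def
proof (intro allI impI, elim conjE)
  fix P :: "'a measure" and \<xi> and X :: "nat \<Rightarrow> 'a \<Rightarrow> real" and n k :: nat and x :: "nat \<Rightarrow> real"
  assume ps: "prob_space P"
    and h: "\<xi> \<in> borel_measurable P"
      "prob_space.indep_vars P (\<lambda>_. borel) X {1..n}"
      "\<forall>i\<in>{1..n}. distr P borel (X i) = distr P borel \<xi>"
      "strict_antimono_on {0..} (tail_prob P \<xi>)" "tail_prob P \<xi> 0 = 1"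
      "convex_on {0..} (log_tail P \<xi>)" "1 < k" "k + k0 P \<xi> k \<le> n"
      "antimono_on {1..n} x" "\<forall>i\<in>{1..n}. 0 < x i"
  interpret prob_space P by fact
  interpret weighted_order_statistic P \<xi> X n k x
    using h by unfold_locales auto
  show "1 / 4 * (max_term P \<xi> k x + inverse (1 + ln (8 * (real k - 1)) / log_tail P \<xi> 1) * sum_term P \<xi> n k x)
      \<le> (LINT \<omega>|P. k_max k (map (\<lambda>i. \<bar>x i * X i \<omega>\<bar>) [1..<n + 1])) \<and>
    (LINT \<omega>|P. k_max k (map (\<lambda>i. \<bar>x i * X i \<omega>\<bar>) [1..<n + 1]))
      \<le> 128 * exp 1 * (max (log_tail P \<xi> 1) (1 / log_tail P \<xi> 1) * ln (real k + 1) * max_term P \<xi> k x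
        + sum_term P \<xi> n k x)"
    using lower_estimate upper_estimate unfolding Kmax_def by blast
qed

subsection \<open>Change of sample space\<close>

lemma tail_prob_distr:
  assumes [measurable]: "Y \<in> measurable P M" "\<xi> \<in> borel_measurable M"
  shows "tail_prob (distr P M Y) \<xi> = tail_prob P (\<lambda>\<omega>. \<xi> (Y \<omega>))"
proof
  fix t
  have "tail_prob (distr P M Y) \<xi> t = measure P (Y -` {y\<in>space M. t < \<bar>\<xi> y\<bar>} \<inter> space P)"
    unfolding tail_prob_def by (subst measure_distr) auto
  also have "Y -` {y\<in>space M. t < \<bar>\<xi> y\<bar>} \<inter> space P = {\<omega>\<in>space P. t < \<bar>\<xi> (Y \<omega>)\<bar>}"
    using measurable_space[OF assms(1)] by auto
  finally show "tail_prob (distr P M Y) \<xi> t = tail_prob P (\<lambda>\<omega>. \<xi> (Y \<omega>)) t"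
    by (simp add: tail_prob_def)
qed

lemma tail_orlicz_distr:
  assumes [measurable]: "Y \<in> measurable P M" "\<xi> \<in> borel_measurable M"
  shows "tail_orlicz (distr P M Y) \<xi> = tail_orlicz P (\<lambda>\<omega>. \<xi> (Y \<omega>))"
proof
  fix s
  have "(LINT y:{y\<in>space (distr P M Y). 1 / t \<le> \<bar>\<xi> y\<bar>}|distr P M Y. \<bar>\<xi> y\<bar>)
      = (LINT \<omega>:{\<omega>\<in>space P. 1 / t \<le> \<bar>\<xi> (Y \<omega>)\<bar>}|P. \<bar>\<xi> (Y \<omega>)\<bar>)" for t
    unfolding set_lebesgue_integral_def
    by (subst integral_distr)
      (auto intro!: Bochner_Integration.integral_cong simp: indicator_def measurable_space[OF assms(1)])
  then show "tail_orlicz (distr P M Y) \<xi> s = tail_orlicz P (\<lambda>\<omega>. \<xi> (Y \<omega>)) s"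
    unfolding tail_orlicz_def by simp
qed

text \<open>For a nonempty family, independence means that the joint law is the product of the
  marginals, and both laws are unchanged when the variables are evaluated under the law of
  \<open>Y\<close>.\<close>

lemma (in prob_space) indep_vars_distr:
  assumes Y [measurable]: "Y \<in> measurable M S" and "I \<noteq> {}"
    and [measurable]: "\<And>i. i \<in> I \<Longrightarrow> Z i \<in> measurable S (M' i)"
    and ind: "indep_vars M' (\<lambda>i \<omega>. Z i (Y \<omega>)) I"
  shows "prob_space.indep_vars (distr M S Y) M' Z I"
proof -
  interpret D: prob_space "distr M S Y" by (rule prob_space_distr) fact
  have "distr (distr M S Y) (\<Pi>\<^sub>M i\<in>I. M' i) (\<lambda>y. \<lambda>i\<in>I. Z i y)
      = distr M (\<Pi>\<^sub>M i\<in>I. M' i) (\<lambda>\<omega>. \<lambda>i\<in>I. Z i (Y \<omega>))"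
    by (subst distr_distr) (auto simp: o_def intro!: measurable_restrict)
  also have "\<dots> = (\<Pi>\<^sub>M i\<in>I. distr M (M' i) (\<lambda>\<omega>. Z i (Y \<omega>)))"
    using ind \<open>I \<noteq> {}\<close> by (subst (asm) indep_vars_iff_distr_eq_PiM') auto
  also have "\<dots> = (\<Pi>\<^sub>M i\<in>I. distr (distr M S Y) (M' i) (Z i))"
    by (intro PiM_cong) (auto simp: distr_distr o_def)
  finally show ?thesis
    using \<open>I \<noteq> {}\<close> by (subst D.indep_vars_iff_distr_eq_PiM') auto
qed

text \<open>
  For the second conjunct, the joint law of \<open>(\<xi>, X\<^sub>1, \<dots>, X\<^sub>n)\<close> realises the same data on the sample
  space \<open>nat \<Rightarrow> real\<close>.
\<close>

lemma admissible_constant_transfer: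
  assumes "admissible_constant TYPE(nat \<Rightarrow> real) c"
  shows "admissible_constant TYPE('a) c"
  unfolding admissible_constant_def
proof (intro allI impI, elim conjE)
  fix P :: "'a measure" and \<xi> and X :: "nat \<Rightarrow> 'a \<Rightarrow> real" and n k :: nat and x :: "nat \<Rightarrow> real"
  assume ps: "prob_space P"
    and \<xi>[measurable]: "\<xi> \<in> borel_measurable P"
    and ind: "prob_space.indep_vars P (\<lambda>_. borel) X {1..n}"
    and h: "\<forall>i\<in>{1..n}. distr P borel (X i) = distr P borel \<xi>"
      "strict_antimono_on {0..} (tail_prob P \<xi>)" "tail_prob P \<xi> 0 = 1"
      "convex_on {0..} (log_tail P \<xi>)" "1 < k" "k \<le> n" "k + k0 P \<xi> k \<le> n"
      "antimono_on {1..n} x" "\<forall>i\<in>{1..n}. 0 < x i"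
  interpret prob_space P by fact
  define S :: "(nat \<Rightarrow> real) measure" where "S = (\<Pi>\<^sub>M i\<in>UNIV. borel)"
  \<comment> \<open>Coordinate 0 is free to carry \<open>\<xi>\<close> because the sample is indexed
    from 1; coordinates past \<open>n\<close> are filled with 0.\<close>
  define Y where "Y \<omega> i = (if i = 0 then \<xi> \<omega> else if i \<le> n then X i \<omega> else 0)" for \<omega> and i :: nat
  define Q where "Q = distr P S Y"
  have X: "X i \<in> borel_measurable P" if "1 \<le> i" "i \<le> n" for i
    using ind that by (auto simp: indep_vars_def)
  have Y[measurable]: "Y \<in> measurable P S"
    unfolding S_def
  proof (rule measurable_PiM_single')
    fix i :: nat
    show "(\<lambda>\<omega>. Y \<omega> i) \<in> borel_measurable P"
      using X[of i] by (cases "i = 0"; cases "i \<le> n") (simp_all add: Y_def)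
  qed auto
  have comp[measurable]: "(\<lambda>f. f i) \<in> borel_measurable S" for i
    unfolding S_def by (rule measurable_component_singleton) simp
  have Y0: "(\<lambda>\<omega>. Y \<omega> 0) = \<xi>" by (simp add: Y_def)
  have Yi: "(\<lambda>\<omega>. Y \<omega> i) = X i" if "i \<in> {1..n}" for i using that by (auto simp: Y_def)
  \<comment> \<open>The terms of the estimate are built from the law of \<open>\<xi>\<close>, so
    they agree on both sample spaces.\<close>
  have tail: "tail_prob Q (\<lambda>f. f 0) = tail_prob P \<xi>"
    unfolding Q_def by (subst tail_prob_distr) (simp_all add: Y0)
  have log: "log_tail Q (\<lambda>f. f 0) = log_tail P \<xi>"
    unfolding log_tail_def tail ..
  have orl: "tail_orlicz Q (\<lambda>f. f 0) = tail_orlicz P \<xi>"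
    unfolding Q_def by (subst tail_orlicz_distr) (simp_all add: Y0)
  have k0: "k0 Q (\<lambda>f. f 0) = k0 P \<xi>"
    unfolding k0_def tail ..
  have max: "max_term Q (\<lambda>f. f 0) = max_term P \<xi>"
    unfolding max_term_def k0 log ..
  have sum: "sum_term Q (\<lambda>f. f 0) = sum_term P \<xi>"
    unfolding sum_term_def k0 orl ..
  have distr_Q: "distr Q borel (\<lambda>f. f i) = distr P borel (\<lambda>\<omega>. Y \<omega> i)" for i
    unfolding Q_def by (subst distr_distr) (auto simp: o_def)
  have "indep_vars (\<lambda>_. borel) (\<lambda>i \<omega>. Y \<omega> i) {1..n}"
    using ind by (subst indep_vars_cong[OF refl Yi refl])
  then have ind_Q: "prob_space.indep_vars Q (\<lambda>_. borel) (\<lambda>i f. f i) {1..n}"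
    unfolding Q_def using h by (intro indep_vars_distr) auto
  have kmax_meas: "(\<lambda>f. k_max k (map (\<lambda>i. \<bar>x i * f i\<bar>) [1..<n + 1])) \<in> borel_measurable S"
    using h by (intro borel_measurable_k_max) auto
  have kmax: "(LINT f|Q. k_max k (map (\<lambda>i. \<bar>x i * f i\<bar>) [1..<n + 1]))
      = (LINT \<omega>|P. k_max k (map (\<lambda>i. \<bar>x i * X i \<omega>\<bar>) [1..<n + 1]))"
  proof -
    have *: "map (\<lambda>i. \<bar>x i * Y \<omega> i\<bar>) [1..<n + 1] = map (\<lambda>i. \<bar>x i * X i \<omega>\<bar>) [1..<n + 1]" for \<omega>
      by (rule map_cong[OF refl]) (auto simp: Y_def)
    show ?thesis unfolding Q_def by (subst integral_distr[OF Y kmax_meas]) (simp only: *)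
  qed
  have "prob_space Q" unfolding Q_def by (rule prob_space_distr[OF Y])
  moreover have "(\<lambda>f. f 0) \<in> borel_measurable Q" unfolding Q_def by simp
  moreover have "\<forall>i\<in>{1..n}. distr Q borel (\<lambda>f. f i) = distr Q borel (\<lambda>f. f 0)"
    using h(1) Yi by (simp add: distr_Q Y0)
  moreover note assms[unfolded admissible_constant_def Let_def, rule_format,
      of Q "\<lambda>f. f 0" "\<lambda>i f. f i" n k x, unfolded tail log k0 max sum kmax]
  ultimately show "let N = log_tail P \<xi>; C_N = max (N 1) (1 / N 1);
        E_kmax = (LINT \<omega>|P. k_max k (map (\<lambda>i. \<bar>x i * X i \<omega>\<bar>) [1..<n + 1]))
      in 1 / 4 * (max_term P \<xi> k x + inverse (1 + ln (8 * (real k - 1)) / N 1) * sum_term P \<xi> n k x)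
          \<le> E_kmax \<and>
        E_kmax \<le> c * (C_N * ln (real k + 1) * max_term P \<xi> k x + sum_term P \<xi> n k x)"
    using h ind_Q unfolding Let_def by blast
qed

theorem theorem2:
  shows "(\<exists>c>0. admissible_constant TYPE(nat \<Rightarrow> real) c) \<and>
         (\<forall>c>0. admissible_constant TYPE(nat \<Rightarrow> real) c \<longrightarrow> admissible_constant TYPE('a) c)"
proof
  have "0 < 128 * exp (1::real)" by simp
  then show "\<exists>c>0. admissible_constant TYPE(nat \<Rightarrow> real) c"
    using admissible_constant_universal by blast
  show "\<forall>c>0. admissible_constant TYPE(nat \<Rightarrow> real) c \<longrightarrow> admissible_constant TYPE('a) c"
    using admissible_constant_transfer by blast
qed

end
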